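(* Let $m\ge2$ be an integer and $d_k'=\gcd(k,m)$ for $k=2,3$. Then $$[\mathbb{O}^-]\circledcirc[\mathbb{Z}_m\oplus\mathbb{Z}_2^c]=\begin{cases}\{[\mathbb{1}],[\mathbb{Z}_2^-],[\mathbb{Z}_{d_3'}],[\mathbb{Z}_4^-]\}&\text{if } 4\mid m,\\ \{[\mathbb{1}],[\mathbb{Z}_{d_2'}],[\mathbb{Z}_{d_2'}^-],[\mathbb{Z}_{d_3'}]\}&\text{otherwise},\end{cases}$$ where $[\mathbb{Z}_1^-]$ is understood as $[\mathbb{1}]$.
   Context: $[K]$ is the conjugacy class of a subgroup $K$ in $\mathrm{O}(3)$, and the clips operation is $[H_1]\circledcirc[H_2]=\{[H_1\cap gH_2g^{-1}]:g\in\mathrm{O}(3)\}$. $(e_1,e_2,e_3)$ is the canonical basis of $\mathbb{R}^3$, $\mathbf{r}(n,\theta)$ is the rotation by angle $\theta$ about the axis directed by $n\neq0$. $\mathbb{1}=\{\mathrm{Id}\}$; $\mathbb{Z}_2^c=\{\pm\mathrm{Id}\}$; $H\oplus\mathbb{Z}_2^c=H\cup(-H)$ for $H\subset\mathrm{SO}(3)$; $\mathbb{Z}_k=\{\mathbf{r}(e_3,2j\pi/k):0\le j\le k-1\}$, with $\mathbb{Z}_1=\mathbb{1}$; $\mathbb{Z}_{2k}^-=\mathbb{Z}_k\cup(-\mathbf{r}(e_3,\pi/k))\mathbb{Z}_k$ for $k\ge1$. $\mathbb{T}$ is the rotation group of the regular tetrahedron (order 12), generated by $\mathbf{r}(e_3,\pi),\mathbf{r}(e_1,\pi),\mathbf{r}(e_1+e_2+e_3,2\pi/3)$,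 and $\mathbb{O}^-=\mathbb{T}\cup(-\mathbf{r}(e_3,\pi/2))\mathbb{T}$. *)

theory Defs
  imports "HOL-Analysis.Analysis" "HOL-Algebra.Generated_Groups"
begin

definition O3 :: "(real^3^3) monoid" where
  "O3 = \<lparr>carrier = {A. orthogonal_matrix A}, mult = (**), one = mat 1\<rparr>"

lemma group_O3: "group O3"
proof (rule groupI)
  fix x assume "x \<in> carrier O3"
  then show "\<exists>y\<in>carrier O3. y \<otimes>\<^bsub>O3\<^esub> x = \<one>\<^bsub>O3\<^esub>"
    by (intro bexI[of _ "transpose x"])
      (auto simp: O3_def orthogonal_matrix_def)
qed (auto simp: O3_def orthogonal_matrix_mul orthogonal_matrix_id matrix_mul_assoc)

interpretation O3: group O3 by (rule group_O3)

definition conjugate :: "real^3^3 \<Rightarrow> (real^3^3) set \<Rightarrow> (real^3^3) set" where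
  "conjugate g K = (g <#\<^bsub>O3\<^esub> K) #>\<^bsub>O3\<^esub> inv\<^bsub>O3\<^esub> g"

definition conj_class :: "(real^3^3) set \<Rightarrow> (real^3^3) set set" where
  "conj_class K = {conjugate g K |g. g \<in> carrier O3}"

text \<open>The operation is defined on classes by letting the representatives \<open>H1\<close>, \<open>H2\<close> range over
  the whole classes; lemma \<open>clips_conj_class\<close> below shows that the result can be computed with
  one fixed choice of representatives.\<close>

definition clips :: "(real^3^3) set set \<Rightarrow> (real^3^3) set set \<Rightarrow> (real^3^3) set set set"
    (infixl "\<circledcirc>" 70) where
  "C1 \<circledcirc> C2 =
    (\<Union>H1\<in>C1. \<Union>H2\<in>C2. {conj_class (H1 \<inter> conjugate g H2) |g. g \<in> carrier O3})"

lemma conjugate_image: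
  "conjugate g K = (\<lambda>x. g \<otimes>\<^bsub>O3\<^esub> x \<otimes>\<^bsub>O3\<^esub> inv\<^bsub>O3\<^esub> g) ` K"
  by (auto simp: conjugate_def l_coset_def r_coset_def)

lemma conjugate_subset:
  assumes "g \<in> carrier O3" "K \<subseteq> carrier O3"
  shows "conjugate g K \<subseteq> carrier O3"
  using assms by (auto simp: conjugate_image)

lemma conjugate_one: "K \<subseteq> carrier O3 \<Longrightarrow> conjugate \<one>\<^bsub>O3\<^esub> K = K"
  by (force simp: conjugate_image)

lemma conjugate_conjugate:
  assumes "g \<in> carrier O3" "h \<in> carrier O3" "K \<subseteq> carrier O3"
  shows "conjugate g (conjugate h K) = conjugate (g \<otimes>\<^bsub>O3\<^esub> h) K"
  unfolding conjugate_image image_image using assms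
  by (intro image_cong) (auto simp: O3.m_assoc O3.inv_mult_group subset_iff)

lemma conjugate_Int:
  assumes "g \<in> carrier O3" "H \<subseteq> carrier O3" "K \<subseteq> carrier O3"
  shows "conjugate g (H \<inter> K) = conjugate g H \<inter> conjugate g K"
proof -
  have "inj_on (\<lambda>x. g \<otimes>\<^bsub>O3\<^esub> x \<otimes>\<^bsub>O3\<^esub> inv\<^bsub>O3\<^esub> g) (carrier O3)"
    using assms(1) by (intro inj_onI) simp
  then show ?thesis
    unfolding conjugate_image using assms by (intro inj_on_image_Int) auto
qed

lemma conj_class_conjugate:
  assumes "h \<in> carrier O3" "K \<subseteq> carrier O3"
  shows "conj_class (conjugate h K) = conj_class K"
proof (intro equalityI subsetI)
  fix L assume "L \<in> conj_class (conjugate h K)"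
  then obtain g where "g \<in> carrier O3" "L = conjugate g (conjugate h K)"
    by (auto simp: conj_class_def)
  then have "L = conjugate (g \<otimes>\<^bsub>O3\<^esub> h) K" "g \<otimes>\<^bsub>O3\<^esub> h \<in> carrier O3"
    using assms by (simp_all add: conjugate_conjugate)
  then show "L \<in> conj_class K"
    unfolding conj_class_def by blast
next
  fix L assume "L \<in> conj_class K"
  then obtain g where g: "g \<in> carrier O3" "L = conjugate g K"
    by (auto simp: conj_class_def)
  let ?k = "g \<otimes>\<^bsub>O3\<^esub> inv\<^bsub>O3\<^esub> h"
  have "?k \<in> carrier O3" "L = conjugate ?k (conjugate h K)"
    using g assms by (simp_all add: conjugate_conjugate O3.m_assoc)
  then show "L \<in> conj_class (conjugate h K)"
    unfolding conj_class_def by blast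
qed

lemma clips_conj_class:
  assumes "H1 \<subseteq> carrier O3" "H2 \<subseteq> carrier O3"
  shows "conj_class H1 \<circledcirc> conj_class H2 =
    {conj_class (H1 \<inter> conjugate g H2) |g. g \<in> carrier O3}"
proof (intro equalityI subsetI)
  fix C assume "C \<in> conj_class H1 \<circledcirc> conj_class H2"
  then obtain a b g where abg: "a \<in> carrier O3" "b \<in> carrier O3" "g \<in> carrier O3"
    and C: "C = conj_class (conjugate a H1 \<inter> conjugate g (conjugate b H2))"
    by (auto simp: clips_def conj_class_def)
  let ?h = "inv\<^bsub>O3\<^esub> a \<otimes>\<^bsub>O3\<^esub> (g \<otimes>\<^bsub>O3\<^esub> b)"
  have h: "?h \<in> carrier O3" and ah: "a \<otimes>\<^bsub>O3\<^esub> ?h = g \<otimes>\<^bsub>O3\<^esub> b"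
    using abg by (simp_all add: O3.m_assoc[symmetric])
  have "conjugate a H1 \<inter> conjugate g (conjugate b H2) = conjugate a (H1 \<inter> conjugate ?h H2)"
    using abg h assms ah by (simp add: conjugate_conjugate conjugate_Int conjugate_subset)
  then have "C = conj_class (H1 \<inter> conjugate ?h H2)"
    using C abg assms by (metis conj_class_conjugate le_infI1)
  then show "C \<in> {conj_class (H1 \<inter> conjugate g H2) |g. g \<in> carrier O3}"
    using h by blast
next
  fix C assume "C \<in> {conj_class (H1 \<inter> conjugate g H2) |g. g \<in> carrier O3}"
  moreover have "H \<in> conj_class H" if "H \<subseteq> carrier O3" for H
    using conjugate_one[OF that] O3.one_closed unfolding conj_class_def by blast
  ultimately show "C \<in> conj_class H1 \<circledcirc> conj_class H2"
    using assms unfolding clips_def by blast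
qed

abbreviation e1 :: "real^3" where "e1 \<equiv> axis 1 1"
abbreviation e2 :: "real^3" where "e2 \<equiv> axis 2 1"
abbreviation e3 :: "real^3" where "e3 \<equiv> axis 3 1"

text \<open>Rodrigues' formula for the rotation by angle \<open>\<theta>\<close> about the axis directed by \<open>n \<noteq> 0\<close>.\<close>

definition rot :: "real^3 \<Rightarrow> real \<Rightarrow> real^3^3" where
  "rot n \<theta> = (let u = n /\<^sub>R norm n in
    matrix (\<lambda>v. cos \<theta> *\<^sub>R v + sin \<theta> *\<^sub>R cross3 u v + ((1 - cos \<theta>) * (u \<bullet> v)) *\<^sub>R u))"

definition trivial_grp :: "(real^3^3) set" where
  "trivial_grp = {mat 1}"

definition plus_Z2c :: "(real^3^3) set \<Rightarrow> (real^3^3) set" where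
  "plus_Z2c H = H \<union> uminus ` H"

definition Z_grp :: "nat \<Rightarrow> (real^3^3) set" where
  "Z_grp k = {rot e3 (2 * real j * pi / real k) |j. j < k}"

text \<open>The index is the order of the group, so only even \<open>n = 2 * k\<close> with \<open>k \<ge> 1\<close> are
  meaningful, besides \<open>n = 1\<close>, where the group is trivial by convention.\<close>

definition Z_minus :: "nat \<Rightarrow> (real^3^3) set" where
  "Z_minus n = (if n = 1 then trivial_grp else
    (let k = n div 2 in Z_grp k \<union> ((- rot e3 (pi / real k)) <#\<^bsub>O3\<^esub> Z_grp k)))"

definition T_grp :: "(real^3^3) set" where
  "T_grp = generate O3 {rot e3 pi, rot e1 pi, rot (e1 + e2 + e3) (2 * pi / 3)}"

definition O_minus :: "(real^3^3) set" where
  "O_minus = T_grp \<union> ((- rot e3 (pi / 2)) <#\<^bsub>O3\<^esub> T_grp)"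

end

theory Submission
  imports Defs
begin

text \<open>
  The proof rests on one description of \<open>O_minus\<close>: it is the stabiliser in the orthogonal group of
  the cubic form \<open>x\<^sub>1 x\<^sub>2 x\<^sub>3\<close> (\<open>O_minus_eq_stab\<close>). This makes membership of a matrix testable by
  evaluating a polynomial at a few points, and it makes \<open>O_minus\<close> visibly invariant under
  conjugation by its own elements.

  A conjugate of the second group consists of the matrices \<open>\<plusminus> rot u \<theta>\<close> with
  \<open>m \<theta> \<in> 2 \<pi> \<int>\<close>, for some axis \<open>u \<noteq> 0\<close>, and every axis occurs. So the task is to intersect
  \<open>O_minus\<close> with the group attached to each axis.

  If the intersection contains some \<open>A \<noteq> 1\<close>, then \<open>A u = \<plusminus> u\<close>, and differentiating the
  invariance of the cubic form shows that the gradient \<open>q = (u\<^sub>2 u\<^sub>3, u\<^sub>1 u\<^sub>3, u\<^sub>1 u\<^sub>2)\<close> is fixed by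
  \<open>A\<close>. A nontrivial rotation about \<open>u\<close> fixes only multiples of \<open>u\<close>, while minus such a rotation fixes a nonzero
  vector only if it is the reflection in the plane orthogonal to \<open>u\<close>. Each possibility forces \<open>u\<close> to
  be a coordinate axis, a body diagonal or a face diagonal of the cube
  (\<open>coordinates_of_stab_axis\<close>). All axes of one kind are related by elements of \<open>O_minus\<close>
  (\<open>on_tetrahedral_axis_coords\<close>), so it suffices to treat \<open>e\<^sub>3\<close>, \<open>(1,1,1)\<close> and \<open>(1,1,0)\<close>.

  On these axes the matrix \<open>\<epsilon> rot u \<theta>\<close> with \<open>\<epsilon> = \<plusminus> 1\<close> preserves the form exactly if, respectively,
  \<open>cos 2\<theta> = \<epsilon>\<close>; \<open>\<epsilon> = 1\<close> and \<open>cos 3\<theta> = 1\<close>; \<open>cos \<theta> = \<epsilon>\<close>. Combined with \<open>cos m\<theta> = 1\<close> this is elementary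
  arithmetic of angles: \<open>e\<^sub>3\<close> contributes the class of \<open>Z_minus 4\<close> or of \<open>Z_grp (gcd 2 m)\<close> according
  to whether \<open>4\<close> divides \<open>m\<close>, \<open>(1,1,1)\<close> that of \<open>Z_grp (gcd 3 m)\<close>, and \<open>(1,1,0)\<close> that of
  \<open>Z_minus (gcd 2 m)\<close>. The remaining axes, such as \<open>(1,2,3)\<close>, contribute the trivial class.
\<close>

section \<open>Rotations and orthogonal matrices\<close>

lemma carrier_O3 [simp]: "A \<in> carrier O3 \<longleftrightarrow> orthogonal_matrix A"
  by (simp add: O3_def)

lemma mult_O3 [simp]: "A \<otimes>\<^bsub>O3\<^esub> B = A ** B"
  by (simp add: O3_def)

lemma one_O3 [simp]: "\<one>\<^bsub>O3\<^esub> = mat 1"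
  by (simp add: O3_def)

lemma inv_O3: "orthogonal_matrix A \<Longrightarrow> inv\<^bsub>O3\<^esub> A = transpose A"
  by (rule O3.inv_equality) (auto simp: orthogonal_matrix_def)

lemma rot_apply:
  "rot n \<theta> *v v = (let u = n /\<^sub>R norm n in
     cos \<theta> *\<^sub>R v + sin \<theta> *\<^sub>R cross3 u v + ((1 - cos \<theta>) * (u \<bullet> v)) *\<^sub>R u)"
proof -
  define u where "u = n /\<^sub>R norm n"
  have "linear (\<lambda>v. cos \<theta> *\<^sub>R v + sin \<theta> *\<^sub>R cross3 u v + ((1 - cos \<theta>) * (u \<bullet> v)) *\<^sub>R u)"
    by (rule linearI) (simp_all add: cross3_def vec_eq_iff inner_vec_def sum_3 forall_3 algebra_simps)
  then show ?thesis
    unfolding rot_def Let_def u_def by simp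
qed

lemma rot_apply_unit:
  assumes "norm u = 1"
  shows "rot u \<theta> *v v = cos \<theta> *\<^sub>R v + sin \<theta> *\<^sub>R cross3 u v + ((1 - cos \<theta>) * (u \<bullet> v)) *\<^sub>R u"
  using assms by (simp add: rot_apply)

lemma rot_scaleR:
  assumes "k \<noteq> 0"
  shows "rot (k *\<^sub>R n) \<theta> = rot n (sgn k * \<theta>)"
proof -
  have "rot (k *\<^sub>R n) \<theta> *v v = rot n (sgn k * \<theta>) *v v" for v
  proof -
    define u where "u = n /\<^sub>R norm n"
    have "(k *\<^sub>R n) /\<^sub>R norm (k *\<^sub>R n) = sgn k *\<^sub>R u"
      by (simp add: u_def sgn_real_def)
    then show ?thesis
      using assms by (simp add: rot_apply Let_def u_def[symmetric] sgn_real_def cross_mult_left cross_minus_left)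
  qed
  then show ?thesis by (simp add: matrix_eq)
qed

lemma rot_normalize: "n \<noteq> 0 \<Longrightarrow> rot (n /\<^sub>R norm n) \<theta> = rot n \<theta>"
  by (simp add: rot_scaleR)

lemma rot_cong: "cos \<theta> = cos \<phi> \<Longrightarrow> sin \<theta> = sin \<phi> \<Longrightarrow> rot n \<theta> = rot n \<phi>"
  by (simp add: rot_def)

lemma rot_trivial: "cos \<theta> = 1 \<Longrightarrow> rot n \<theta> = mat 1"
  using cos_one_sin_zero[of \<theta>] by (simp add: matrix_eq rot_apply)

lemma rot_add:
  assumes "n \<noteq> 0"
  shows "rot n \<alpha> ** rot n \<beta> = rot n (\<alpha> + \<beta>)"
proof -
  define u where "u = n /\<^sub>R norm n"
  have nu: "norm u = 1" and u: "u \<bullet> u = 1"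
    using assms by (simp_all add: u_def dot_square_norm power2_eq_square)
  have "rot u \<alpha> *v (rot u \<beta> *v v) = rot u (\<alpha> + \<beta>) *v v" for v
    by (simp add: rot_apply_unit nu cross_add_right cross_mult_right Lagrange u cos_add
        sin_add inner_add_right dot_cross_self algebra_simps)
  then show ?thesis
    using rot_normalize[OF assms] by (simp add: matrix_eq matrix_vector_mul_assoc[symmetric] u_def)
qed

text \<open>In Rodrigues' formula only the skew part, the cross product, changes sign under transposition,
  and it carries the factor \<open>sin \<theta>\<close>.\<close>
lemma transpose_rot: "transpose (rot n \<theta>) = rot n (- \<theta>)"
  by (simp add: rot_def Let_def matrix_def transpose_def vec_eq_iff forall_3 cross3_def
      inner_vec_def sum_3 axis_def algebra_simps)

lemma orthogonal_rot: "n \<noteq> 0 \<Longrightarrow> orthogonal_matrix (rot n \<theta>)"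
  by (simp add: orthogonal_matrix transpose_rot rot_add rot_trivial)

lemma inner_orthogonal_matrix:
  fixes A :: "real^'n^'n"
  assumes "orthogonal_matrix A"
  shows "(A *v x) \<bullet> (A *v y) = x \<bullet> y"
  using assms orthogonal_transformation_matrix[of "(*v) A"]
  by (simp add: orthogonal_transformation_def)

lemma norm_orthogonal_matrix:
  fixes A :: "real^'n^'n"
  shows "orthogonal_matrix A \<Longrightarrow> norm (A *v x) = norm x"
  by (simp add: norm_eq_sqrt_inner inner_orthogonal_matrix)

lemma orthogonal_matrix_eq_0_iff:
  fixes A :: "real^'n^'n"
  shows "orthogonal_matrix A \<Longrightarrow> A *v x = 0 \<longleftrightarrow> x = 0"
  using norm_orthogonal_matrix[of A x] by (metis norm_eq_zero)

text \<open>An orthogonal matrix carries the cross product to itself up to its determinant, so a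
  conjugation that reverses orientation moves the axis and reverses the angle.\<close>
lemma rot_conj:
  assumes g: "orthogonal_matrix g"
  shows "g ** rot n \<theta> ** transpose g = rot (g *v n) (det g * \<theta>)"
proof -
  define u where "u = n /\<^sub>R norm n"
  have gu: "(g *v n) /\<^sub>R norm (g *v n) = g *v u"
    by (simp add: u_def norm_orthogonal_matrix[OF g] matrix_vector_mult_scaleR)
  have sc: "cos (det g * \<theta>) = cos \<theta>" "sin (det g * \<theta>) = det g * sin \<theta>"
    using det_orthogonal_matrix[OF g] by auto
  have [simp]: "det g * det g = 1"
    using det_orthogonal_matrix[OF g] by auto
  have "g *v (rot n \<theta> *v v) = rot (g *v n) (det g * \<theta>) *v (g *v v)" for v
    unfolding rot_apply Let_def gu sc
    by (simp add: u_def[symmetric] cross_orthogonal_matrix[OF g] inner_orthogonal_matrix[OF g]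
        matrix_vector_mult_scaleR matrix_vector_right_distrib mult.commute)
  then have "g ** rot n \<theta> = rot (g *v n) (det g * \<theta>) ** g"
    by (simp add: matrix_eq matrix_vector_mul_assoc)
  then show ?thesis
    using g by (simp add: matrix_mul_assoc[symmetric] orthogonal_matrix_def)
qed

section \<open>The stabiliser of the product of the coordinates\<close>

definition coord_prod :: "real^3 \<Rightarrow> real" where
  "coord_prod x = x$1 * x$2 * x$3"

text \<open>The gradient of \<open>coord_prod\<close>.\<close>
definition coord_grad :: "real^3 \<Rightarrow> real^3" where
  "coord_grad x = vector [x$2 * x$3, x$1 * x$3, x$1 * x$2]"

definition coord_prod_stab :: "(real^3^3) set" where
  "coord_prod_stab = {A. orthogonal_matrix A \<and> (\<forall>x. coord_prod (A *v x) = coord_prod x)}"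

lemma stab_mult: "A \<in> coord_prod_stab \<Longrightarrow> B \<in> coord_prod_stab \<Longrightarrow> A ** B \<in> coord_prod_stab"
  by (simp add: coord_prod_stab_def orthogonal_matrix_mul matrix_vector_mul_assoc[symmetric])

lemma stab_transpose:
  assumes "A \<in> coord_prod_stab" shows "transpose A \<in> coord_prod_stab"
proof -
  have A: "orthogonal_matrix A" "\<And>x. coord_prod (A *v x) = coord_prod x"
    using assms by (auto simp: coord_prod_stab_def)
  then have "coord_prod (transpose A *v x) = coord_prod x" for x
    by (metis matrix_vector_mul_assoc matrix_vector_mul_lid orthogonal_matrix_def)
  with A show ?thesis by (simp add: coord_prod_stab_def orthogonal_matrix_transpose)
qed

lemma stab_one: "mat 1 \<in> coord_prod_stab"
  by (simp add: coord_prod_stab_def orthogonal_matrix_id)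

lemma conjugate_stab:
  assumes h: "h \<in> coord_prod_stab"
  shows "conjugate h coord_prod_stab = coord_prod_stab"
proof -
  have o: "orthogonal_matrix h" using h by (simp add: coord_prod_stab_def)
  have "x \<in> (\<lambda>x. h ** x ** transpose h) ` coord_prod_stab" if "x \<in> coord_prod_stab" for x
  proof (rule image_eqI)
    show "x = h ** (transpose h ** x ** h) ** transpose h"
      using o by (metis matrix_mul_assoc matrix_mul_lid matrix_mul_rid orthogonal_matrix_def)
    show "transpose h ** x ** h \<in> coord_prod_stab"
      using that h by (intro stab_mult stab_transpose)
  qed
  moreover have "h ** x ** transpose h \<in> coord_prod_stab" if "x \<in> coord_prod_stab" for x
    using that h by (intro stab_mult stab_transpose)
  ultimately show ?thesis
    using o by (auto simp: conjugate_image inv_O3)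
qed

text \<open>The cubic Taylor expansion of \<open>coord_prod\<close> at \<open>x\<close> recovers the gradient from finitely many
  values; an invariance of the form thus passes to its gradient without any differentiation.\<close>
lemma inner_coord_grad:
  "coord_grad x \<bullet> y = (coord_prod (x + y) - coord_prod (x - y)) / 2 - coord_prod y"
  by (simp add: coord_grad_def coord_prod_def inner_vec_def sum_3 field_simps)

lemma coord_grad_equivariant:
  assumes "A \<in> coord_prod_stab"
  shows "coord_grad (A *v x) = A *v coord_grad x"
proof -
  have o: "orthogonal_matrix A" and inv: "\<And>x. coord_prod (A *v x) = coord_prod x"
    using assms by (auto simp: coord_prod_stab_def)
  have 1: "coord_grad (A *v x) \<bullet> (A *v y) = (A *v coord_grad x) \<bullet> (A *v y)" for y
    by (simp add: inner_orthogonal_matrix[OF o] inner_coord_grad inv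
        flip: matrix_vector_right_distrib matrix_vector_mult_diff_distrib)
  have "coord_grad (A *v x) \<bullet> z = (A *v coord_grad x) \<bullet> z" for z
    using 1[of "transpose A *v z"] o
    unfolding matrix_vector_mul_assoc[of A "transpose A"] by (simp add: orthogonal_matrix_def)
  then show ?thesis by (metis vector_eq_rdot)
qed

section \<open>Rotations about the three reference axes in the stabiliser\<close>

definition body_diagonal :: "real^3" where
  "body_diagonal = e1 + e2 + e3"

definition face_diagonal :: "real^3" where
  "face_diagonal = e1 + e2"

lemma body_diagonal_nonzero: "body_diagonal \<noteq> 0"
  and face_diagonal_nonzero: "face_diagonal \<noteq> 0"
  by (simp_all add: body_diagonal_def face_diagonal_def vec_eq_iff forall_3 axis_def)

lemmas coord_simps = matrix_vector_mult_def vec_eq_iff forall_3 sum_3 axis_def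
  inner_vec_def cross3_def

lemma rot_e3_apply:
  "rot e3 \<theta> *v x = vector [cos \<theta> * x$1 - sin \<theta> * x$2, sin \<theta> * x$1 + cos \<theta> * x$2, x$3]"
  unfolding rot_apply_unit[OF norm_axis_1] by (simp add: coord_simps algebra_simps)

lemma rot_e1_apply:
  "rot e1 \<theta> *v x = vector [x$1, cos \<theta> * x$2 - sin \<theta> * x$3, sin \<theta> * x$2 + cos \<theta> * x$3]"
  unfolding rot_apply_unit[OF norm_axis_1] by (simp add: coord_simps algebra_simps)

lemma norm_body_diagonal: "norm body_diagonal = sqrt 3"
  by (simp add: body_diagonal_def norm_eq_sqrt_inner inner_vec_def sum_3 axis_def)

lemma norm_face_diagonal: "norm face_diagonal = sqrt 2"
  by (simp add: face_diagonal_def norm_eq_sqrt_inner inner_vec_def sum_3 axis_def)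

text \<open>The rotations about the body diagonal are circulant matrices, because they commute with the
  cyclic permutation of the coordinates.\<close>
lemma rot_body_diagonal_apply:
  fixes \<theta>
  defines "a \<equiv> (1 + 2 * cos \<theta>) / 3" and "b \<equiv> (1 - cos \<theta>) / 3 - sin \<theta> / sqrt 3"
    and "c \<equiv> (1 - cos \<theta>) / 3 + sin \<theta> / sqrt 3"
  shows "rot body_diagonal \<theta> *v x = vector
    [a * x$1 + b * x$2 + c * x$3, c * x$1 + a * x$2 + b * x$3, b * x$1 + c * x$2 + a * x$3]"
proof -
  define r where "r = inverse (sqrt 3)"
  have r: "r * r = 1 / 3" "r * (r * y) = y / 3" for y
    by (simp_all add: r_def field_simps)
  show ?thesis
    unfolding rot_apply Let_def norm_body_diagonal a_def b_def c_def divide_inverse[of _ "sqrt 3"]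
      r_def[symmetric]
    by (simp add: coord_simps body_diagonal_def r algebra_simps add_divide_distrib diff_divide_distrib)
qed

lemma rot_face_diagonal_apply:
  fixes \<theta>
  defines "a \<equiv> (1 + cos \<theta>) / 2" and "b \<equiv> (1 - cos \<theta>) / 2" and "s \<equiv> sin \<theta> / sqrt 2"
  shows "rot face_diagonal \<theta> *v x = vector
    [a * x$1 + b * x$2 + s * x$3, b * x$1 + a * x$2 - s * x$3, s * x$2 - s * x$1 + cos \<theta> * x$3]"
  unfolding rot_apply Let_def norm_face_diagonal by (simp add: face_diagonal_def coord_simps a_def b_def s_def field_simps)

lemma scaleR_rot_in_stab_iff:
  assumes "n \<noteq> 0" "\<epsilon> = 1 \<or> \<epsilon> = -1"
  shows "\<epsilon> *\<^sub>R rot n \<theta> \<in> coord_prod_stab \<longleftrightarrow> (\<forall>x. \<epsilon> * coord_prod (rot n \<theta> *v x) = coord_prod x)"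
proof -
  have "orthogonal_matrix (\<epsilon> *\<^sub>R rot n \<theta>)"
    using assms(2) orthogonal_rot[OF assms(1), of \<theta>]
    by (auto simp: orthogonal_matrix_def transpose_def matrix_matrix_mult_def vec_eq_iff)
  moreover have "coord_prod (\<epsilon> *\<^sub>R rot n \<theta> *v x) = \<epsilon> * coord_prod (rot n \<theta> *v x)" for x
    using assms(2) by (auto simp: coord_prod_def scaleR_matrix_vector_assoc[symmetric])
  ultimately show ?thesis by (simp add: coord_prod_stab_def)
qed

text \<open>On each horizontal plane the form is a multiple of \<open>x\<^sub>1 x\<^sub>2\<close>, and a rotation by \<open>\<theta>\<close> acts on the
  span of \<open>x\<^sub>1 x\<^sub>2\<close> and \<open>x\<^sub>1\<^sup>2 - x\<^sub>2\<^sup>2\<close> through \<open>cos 2\<theta>\<close> and \<open>sin 2\<theta>\<close>.\<close>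
lemma e3_rot_in_stab_iff:
  assumes "\<epsilon> = 1 \<or> \<epsilon> = -1"
  shows "\<epsilon> *\<^sub>R rot e3 \<theta> \<in> coord_prod_stab \<longleftrightarrow> cos (2 * \<theta>) = \<epsilon>"
proof -
  have *: "coord_prod (rot e3 \<theta> *v x) = x$3 * (sin (2 * \<theta>) / 2 * ((x$1)\<^sup>2 - (x$2)\<^sup>2) + cos (2 * \<theta>) * x$1 * x$2)"
    for x unfolding rot_e3_apply coord_prod_def sin_double cos_double
    by (simp add: algebra_simps power2_eq_square)
  have "\<epsilon> *\<^sub>R rot e3 \<theta> \<in> coord_prod_stab \<longleftrightarrow> (\<forall>x. \<epsilon> * coord_prod (rot e3 \<theta> *v x) = coord_prod x)"
    using assms by (intro scaleR_rot_in_stab_iff) (simp_all add: axis_eq_0_iff)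
  also have "\<dots> \<longleftrightarrow> cos (2 * \<theta>) = \<epsilon>"
  proof
    assume "\<forall>x. \<epsilon> * coord_prod (rot e3 \<theta> *v x) = coord_prod x"
    from this[rule_format, of "vector [1,1,1]"] show "cos (2 * \<theta>) = \<epsilon>"
      using assms unfolding * by (auto simp: coord_prod_def)
  next
    assume c: "cos (2 * \<theta>) = \<epsilon>"
    then have "sin (2 * \<theta>) = 0"
      using assms sin_cos_squared_add[of "2 * \<theta>"] by auto
    then show "\<forall>x. \<epsilon> * coord_prod (rot e3 \<theta> *v x) = coord_prod x"
      using assms unfolding * c by (auto simp: coord_prod_def)
  qed
  finally show ?thesis .
qed

text \<open>The image of the diagonal itself determines \<open>\<epsilon>\<close>. At \<open>e\<^sub>1\<close> the form vanishes, while its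
  value at the image of \<open>e\<^sub>1\<close> is \<open>2 / 27 * (cos 3\<theta> - 1)\<close>, so invariance forces \<open>cos 3\<theta> = 1\<close>; the matrix is then one of the
  three cyclic permutations.\<close>
lemma body_diagonal_rot_in_stab_iff:
  assumes "\<epsilon> = 1 \<or> \<epsilon> = -1"
  shows "\<epsilon> *\<^sub>R rot body_diagonal \<theta> \<in> coord_prod_stab \<longleftrightarrow> \<epsilon> = 1 \<and> cos (3 * \<theta>) = 1"
proof -
  have "\<epsilon> *\<^sub>R rot body_diagonal \<theta> \<in> coord_prod_stab \<longleftrightarrow> (\<forall>x. \<epsilon> * coord_prod (rot body_diagonal \<theta> *v x) = coord_prod x)"
    using body_diagonal_nonzero assms by (intro scaleR_rot_in_stab_iff)
  also have "\<dots> \<longleftrightarrow> \<epsilon> = 1 \<and> cos (3 * \<theta>) = 1"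
  proof
    assume *: "\<forall>x. \<epsilon> * coord_prod (rot body_diagonal \<theta> *v x) = coord_prod x"
    have "rot body_diagonal \<theta> *v vector [1,1,1] = vector [1,1,1]"
      by (simp add: rot_body_diagonal_apply add_divide_distrib diff_divide_distrib)
    then have "\<epsilon> = 1"
      using *[rule_format, of "vector [1,1,1]"] by (simp add: coord_prod_def)
    moreover have "coord_prod (rot body_diagonal \<theta> *v vector [1,0,0]) = 0"
      using *[rule_format, of "vector [1,0,0]"] assms by (auto simp: coord_prod_def)
    moreover have "coord_prod (rot body_diagonal \<theta> *v vector [1,0,0]) = 2 / 27 * (cos (3 * \<theta>) - 1)"
    proof -
      have "coord_prod (rot body_diagonal \<theta> *v vector [1,0,0])
        = (1 + 2 * cos \<theta>) / 3 * (((1 - cos \<theta>) / 3 + sin \<theta> / sqrt 3) * ((1 - cos \<theta>) / 3 - sin \<theta> / sqrt 3))"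
        by (simp add: rot_body_diagonal_apply coord_prod_def)
      also have "\<dots> = (1 + 2 * cos \<theta>) / 3 * (((1 - cos \<theta>) / 3)\<^sup>2 - (sin \<theta>)\<^sup>2 / 3)"
        unfolding square_diff_square_factored[symmetric] power2_eq_square[symmetric] power_divide by simp
      also have "\<dots> = 2 / 27 * (cos (3 * \<theta>) - 1)"
        unfolding cos_treble_cos sin_squared_eq by (simp add: field_simps power2_eq_square power3_eq_cube)
      finally show ?thesis .
    qed
    ultimately show "\<epsilon> = 1 \<and> cos (3 * \<theta>) = 1" by simp
  next
    assume *: "\<epsilon> = 1 \<and> cos (3 * \<theta>) = 1"
    then have "(cos \<theta> - 1) * (2 * cos \<theta> + 1)\<^sup>2 = 0"
      unfolding cos_treble_cos by (simp add: algebra_simps power2_eq_square power3_eq_cube)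
    then consider "cos \<theta> = 1" | "cos \<theta> = -1/2" by auto
    then show "\<forall>x. \<epsilon> * coord_prod (rot body_diagonal \<theta> *v x) = coord_prod x"
    proof cases
      case 1
      then show ?thesis using * by (simp add: rot_trivial)
    next
      case 2
      then have "(sin \<theta>)\<^sup>2 = 3 / 4" unfolding sin_squared_eq by (simp add: power2_eq_square)
      then have "(sin \<theta> / sqrt 3)\<^sup>2 = (1/2)\<^sup>2" by (simp add: power_divide)
      then have "sin \<theta> / sqrt 3 = 1/2 \<or> sin \<theta> / sqrt 3 = -1/2" by (simp only: power2_eq_iff) simp
      with 2 * show ?thesis by (auto simp: rot_body_diagonal_apply coord_prod_def)
    qed
  qed
  finally show ?thesis .
qed

text \<open>Along the line \<open>(1,1,t)\<close> the form takes the value \<open>t\<close>, and on the image of this line it is an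
  odd cubic polynomial in \<open>t\<close>. Comparing the two at \<open>t = 1, 2\<close> gives \<open>sin \<theta> = 0\<close>, and then the sign.\<close>
lemma face_diagonal_rot_in_stab_iff:
  assumes "\<epsilon> = 1 \<or> \<epsilon> = -1"
  shows "\<epsilon> *\<^sub>R rot face_diagonal \<theta> \<in> coord_prod_stab \<longleftrightarrow> cos \<theta> = \<epsilon>"
proof -
  have "\<epsilon> *\<^sub>R rot face_diagonal \<theta> \<in> coord_prod_stab \<longleftrightarrow> (\<forall>x. \<epsilon> * coord_prod (rot face_diagonal \<theta> *v x) = coord_prod x)"
    using face_diagonal_nonzero assms by (intro scaleR_rot_in_stab_iff)
  also have "\<dots> \<longleftrightarrow> cos \<theta> = \<epsilon>"
  proof
    assume *: "\<forall>x. \<epsilon> * coord_prod (rot face_diagonal \<theta> *v x) = coord_prod x"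
    have val: "coord_prod (rot face_diagonal \<theta> *v vector [1,1,t]) = t * cos \<theta> * (1 - t\<^sup>2 * (sin \<theta>)\<^sup>2 / 2)" for t
      by (simp add: rot_face_diagonal_apply coord_prod_def field_simps power2_eq_square)
    have 1: "\<epsilon> * cos \<theta> * (1 - (sin \<theta>)\<^sup>2 / 2) = 1"
      using *[rule_format, of "vector [1,1,1]"] unfolding val by (simp add: coord_prod_def mult.assoc)
    have 2: "\<epsilon> * cos \<theta> * (1 - 2 * (sin \<theta>)\<^sup>2) = 1"
      using *[rule_format, of "vector [1,1,2]"] unfolding val by (simp add: coord_prod_def field_simps)
    have "\<epsilon> * cos \<theta> * (sin \<theta>)\<^sup>2 = 2 / 3 * (\<epsilon> * cos \<theta> * (1 - (sin \<theta>)\<^sup>2 / 2)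
        - \<epsilon> * cos \<theta> * (1 - 2 * (sin \<theta>)\<^sup>2))"
      by (simp add: field_simps)
    also have "\<dots> = 0" unfolding 1 2 by simp
    finally have "\<epsilon> * cos \<theta> * (sin \<theta>)\<^sup>2 = 0" .
    moreover have "\<epsilon> * cos \<theta> \<noteq> 0" using 1 by auto
    ultimately have "sin \<theta> = 0" by simp
    with 1 show "cos \<theta> = \<epsilon>" using assms by auto
  next
    assume c: "cos \<theta> = \<epsilon>"
    then have "sin \<theta> = 0"
      using assms sin_cos_squared_add[of \<theta>] by auto
    with c assms show "\<forall>x. \<epsilon> * coord_prod (rot face_diagonal \<theta> *v x) = coord_prod x"
      by (auto simp: coord_prod_def rot_face_diagonal_apply)
  qed
  finally show ?thesis .
qed

section \<open>The group of signed permutations preserving the product\<close>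

text \<open>A rotation is the square of the rotation by half its angle, whose determinant is \<open>\<plusminus> 1\<close>.\<close>
lemma det_rot:
  assumes "n \<noteq> 0"
  shows "det (rot n \<theta>) = 1"
proof -
  have "rot n \<theta> = rot n (\<theta> / 2) ** rot n (\<theta> / 2)"
    using assms by (simp add: rot_add)
  then show ?thesis
    using det_orthogonal_matrix[OF orthogonal_rot[OF assms, of "\<theta> / 2"]] by (auto simp: det_mul)
qed

lemma axis_nonzero: "axis i (1::real) \<noteq> 0"
  by (simp add: axis_eq_0_iff)

abbreviation cyc :: "real^3^3" where "cyc \<equiv> rot body_diagonal (2 * pi / 3)"

lemma cyc_apply: "cyc *v x = vector [x$3, x$1, x$2]"
  by (simp add: rot_body_diagonal_apply cos_120 sin_120 vec_eq_iff forall_3)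

lemma cyc_in_stab: "cyc \<in> coord_prod_stab"
  using body_diagonal_rot_in_stab_iff[of 1 "2 * pi / 3"] by simp

lemma half_turn_in_stab: "rot e3 pi \<in> coord_prod_stab"
  using e3_rot_in_stab_iff[of 1 pi] by simp

lemma roto_quarter_in_stab: "- rot e3 (pi / 2) \<in> coord_prod_stab"
  using e3_rot_in_stab_iff[of "-1" "pi / 2"] by simp

lemma T_grp_generators:
  "{rot e3 pi, rot e1 pi, cyc} \<subseteq> {A \<in> coord_prod_stab. det A = 1}"
proof -
  have "rot e1 pi \<in> coord_prod_stab"
    using axis_nonzero[of 1] orthogonal_rot[of e1 pi]
    by (simp add: coord_prod_stab_def coord_prod_def rot_e1_apply)
  then show ?thesis
    using cyc_in_stab half_turn_in_stab
    by (simp add: det_rot axis_nonzero body_diagonal_nonzero)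
qed

lemma T_grp_subset: "T_grp \<subseteq> {A \<in> coord_prod_stab. det A = 1}"
proof
  fix A assume "A \<in> T_grp"
  then have "A \<in> generate O3 {rot e3 pi, rot e1 pi, cyc}"
    by (simp add: T_grp_def body_diagonal_def)
  then show "A \<in> {A \<in> coord_prod_stab. det A = 1}"
  proof (induction rule: generate.induct)
    case one
    then show ?case by (simp add: stab_one)
  next
    case (incl h)
    then show ?case using T_grp_generators by blast
  next
    case (inv h)
    then have "h \<in> coord_prod_stab" "det h = 1" using T_grp_generators by blast+
    then show ?case
      using stab_transpose[of h] by (simp add: inv_O3 coord_prod_stab_def det_transpose)
  next
    case (eng h1 h2)
    then show ?case by (simp add: stab_mult det_mul)
  qed
qed

lemma subgroup_T_grp: "subgroup T_grp O3"
  unfolding T_grp_def using T_grp_generators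
  by (intro O3.generate_is_subgroup) (auto simp: coord_prod_stab_def body_diagonal_def)

lemma generators_in_T_grp: "rot e3 pi \<in> T_grp" "rot e1 pi \<in> T_grp" "cyc \<in> T_grp"
  by (simp_all add: T_grp_def body_diagonal_def generate.incl)

lemma axis_component: "axis i x $ j = (if j = i then x else 0)"
  by (simp add: axis_def)

text \<open>The pairwise products of the coordinates vanish, so at most one coordinate is nonzero.\<close>
lemma coord_grad_eq_0_cases:
  assumes "coord_grad v = 0" "norm v = 1"
  obtains i where "v = axis i 1 \<or> v = - axis i 1"
proof -
  have "v$2 * v$3 = 0" "v$1 * v$3 = 0" "v$1 * v$2 = 0"
    using assms(1) by (simp_all add: coord_grad_def vec_eq_iff forall_3)
  moreover have "(v$1)\<^sup>2 + (v$2)\<^sup>2 + (v$3)\<^sup>2 = 1"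
    using assms(2) by (simp add: norm_eq_1 inner_vec_def sum_3 power2_eq_square)
  ultimately consider "v$2 = 0" "v$3 = 0" "(v$1)\<^sup>2 = 1" | "v$1 = 0" "v$3 = 0" "(v$2)\<^sup>2 = 1"
    | "v$1 = 0" "v$2 = 0" "(v$3)\<^sup>2 = 1"
    by fastforce
  then have "v = e1 \<or> v = - e1 \<or> v = e2 \<or> v = - e2 \<or> v = e3 \<or> v = - e3"
    by cases (simp_all add: vec_eq_iff forall_3 axis_def power2_eq_1_iff)
  then show ?thesis using that by blast
qed

text \<open>The coordinate axes are the singular points of the cubic form, hence are permuted by its
  stabiliser.\<close>
lemma stab_permutes_axes:
  assumes A: "A \<in> coord_prod_stab"
  obtains i where "A *v axis j 1 = axis i 1 \<or> A *v axis j 1 = - axis i 1"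
proof (rule coord_grad_eq_0_cases)
  have "coord_grad (axis j 1) = 0"
    using exhaust_3[of j] by (auto simp: coord_grad_def vec_eq_iff forall_3 axis_def)
  then show "coord_grad (A *v axis j 1) = 0"
    by (simp add: coord_grad_equivariant[OF A])
  show "norm (A *v axis j 1) = 1"
    using A by (simp add: coord_prod_stab_def norm_orthogonal_matrix norm_axis_1)
qed

lemma matrix_eq_on_axes:
  fixes A B :: "real^3^3"
  assumes "A *v e1 = B *v e1" "A *v e2 = B *v e2" "A *v e3 = B *v e3"
  shows "A = B"
  using assms unfolding matrix_vector_mult_basis by (simp add: column_def vec_eq_iff forall_3)

text \<open>The cross product recovers the image of \<open>e2\<close> from those of \<open>e3\<close> and \<open>e1\<close>. If \<open>e1\<close> and \<open>e2\<close> were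
  exchanged up to sign, the product of the three signs would be negative; so the matrix is diagonal,
  and is one of the half turns about the coordinate axes or the identity.\<close>
lemma stab_fixing_e3_in_T_grp:
  assumes A: "A \<in> coord_prod_stab" "det A = 1" and s: "A *v e3 = \<sigma> *\<^sub>R e3" "\<sigma> = 1 \<or> \<sigma> = -1"
  shows "A \<in> T_grp"
proof -
  have o: "orthogonal_matrix A" using A by (simp add: coord_prod_stab_def)
  obtain i where i: "A *v e1 = axis i 1 \<or> A *v e1 = - axis i 1"
    using stab_permutes_axes[OF A(1)] by blast
  then obtain \<tau> where \<tau>: "\<tau> = 1 \<or> \<tau> = -1" "A *v e1 = \<tau> *\<^sub>R axis i 1"
    by (metis scaleR_minus1_left scaleR_one)
  have e2: "A *v e2 = cross3 (A *v e3) (A *v e1)"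
  proof -
    have "cross3 e3 e1 = e2" by (simp add: coord_simps)
    then show ?thesis using cross_orthogonal_matrix[OF o, of e3 e1] A(2) by simp
  qed
  have "(A *v e3) \<bullet> (A *v e1) = 0"
    by (simp add: inner_orthogonal_matrix[OF o] inner_axis_axis)
  then have "i \<noteq> 3" using s \<tau> by (auto simp: inner_axis_axis)
  moreover have "i \<noteq> 2"
  proof
    assume "i = 2"
    then have "A *v e2 = - (\<sigma> * \<tau>) *\<^sub>R e1"
      using e2 s \<tau> by (simp add: coord_simps)
    then have "coord_prod (A *v (e1 + e2 + e3)) = - (\<sigma> * \<sigma>) * (\<tau> * \<tau>)"
      unfolding matrix_vector_right_distrib s(1) \<tau>(2) \<open>i = 2\<close> by (simp add: coord_prod_def axis_def)
    moreover have "coord_prod (A *v (e1 + e2 + e3)) = 1"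
      using A(1) by (simp add: coord_prod_stab_def coord_prod_def axis_def)
    ultimately show False using s(2) \<tau>(1) by auto
  qed
  ultimately have "i = 1" using exhaust_3[of i] by auto
  then have e1: "A *v e1 = \<tau> *\<^sub>R e1" and e2: "A *v e2 = (\<sigma> * \<tau>) *\<^sub>R e2"
    using e2 s \<tau> by (simp_all add: coord_simps)
  have eq: "A = B" if "B *v e1 = \<tau> *\<^sub>R e1" "B *v e2 = (\<sigma> * \<tau>) *\<^sub>R e2" "B *v e3 = \<sigma> *\<^sub>R e3" for B
    using that e1 e2 s(1) by (intro matrix_eq_on_axes) simp_all
  note half_turns = rot_e3_apply rot_e1_apply vec_eq_iff forall_3 axis_component
  consider "\<sigma> = 1" "\<tau> = 1" | "\<sigma> = 1" "\<tau> = -1" | "\<sigma> = -1" "\<tau> = 1" | "\<sigma> = -1" "\<tau> = -1"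
    using s(2) \<tau>(1) by blast
  then show ?thesis
  proof cases
    case 1
    then have "A = mat 1" by (intro eq) simp_all
    then show ?thesis using subgroup.one_closed[OF subgroup_T_grp] by simp
  next
    case 2
    then have "A = rot e3 pi" by (intro eq) (simp_all add: half_turns)
    then show ?thesis using generators_in_T_grp by simp
  next
    case 3
    then have "A = rot e1 pi" by (intro eq) (simp_all add: half_turns)
    then show ?thesis using generators_in_T_grp by simp
  next
    case 4
    then have "A = rot e1 pi ** rot e3 pi"
      by (intro eq; unfold matrix_vector_mul_assoc[symmetric]) (simp_all add: half_turns)
    then show ?thesis
      using generators_in_T_grp subgroup.m_closed[OF subgroup_T_grp, of "rot e1 pi" "rot e3 pi"] by simp
  qed
qed

text \<open>Multiplication by powers of the cyclic permutation reduces an arbitrary element to one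
  preserving the third axis.\<close>
lemma T_grp_eq: "T_grp = {A \<in> coord_prod_stab. det A = 1}"
proof
  have step: "A \<in> T_grp" if "cyc ** A \<in> T_grp" "A \<in> coord_prod_stab" for A
  proof -
    have "inv\<^bsub>O3\<^esub> cyc \<otimes>\<^bsub>O3\<^esub> (cyc \<otimes>\<^bsub>O3\<^esub> A) = A"
      using that(2) orthogonal_rot[OF body_diagonal_nonzero]
      by (intro O3.inv_solve_left'[THEN iffD2]) (auto simp: coord_prod_stab_def orthogonal_matrix_mul)
    moreover have "inv\<^bsub>O3\<^esub> cyc \<otimes>\<^bsub>O3\<^esub> (cyc \<otimes>\<^bsub>O3\<^esub> A) \<in> T_grp"
      using that(1) generators_in_T_grp(3)
      by (simp add: subgroup.m_closed[OF subgroup_T_grp, simplified]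
          subgroup.m_inv_closed[OF subgroup_T_grp])
    ultimately show ?thesis by simp
  qed
  have cyc_axes: "cyc *v e1 = e2" "cyc *v e2 = e3"
    by (simp_all add: cyc_apply vec_eq_iff forall_3 axis_component)
  have closed: "cyc ** A \<in> coord_prod_stab \<and> det (cyc ** A) = 1" if "A \<in> coord_prod_stab" "det A = 1" for A
    using that by (simp add: stab_mult cyc_in_stab det_mul det_rot body_diagonal_nonzero)
  have 3: "A \<in> T_grp" if "A \<in> coord_prod_stab" "det A = 1" "A *v e3 = e3 \<or> A *v e3 = - e3" for A
    using that stab_fixing_e3_in_T_grp[of A 1] stab_fixing_e3_in_T_grp[of A "-1"] by auto
  have 2: "A \<in> T_grp" if "A \<in> coord_prod_stab" "det A = 1" "A *v e3 = e2 \<or> A *v e3 = - e2" for A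
    using that closed[of A] 3[of "cyc ** A"] step[of A] cyc_axes
    by (auto simp: vec.neg simp flip: matrix_vector_mul_assoc)
  have 1: "A \<in> T_grp" if "A \<in> coord_prod_stab" "det A = 1" "A *v e3 = e1 \<or> A *v e3 = - e1" for A
    using that closed[of A] 2[of "cyc ** A"] step[of A] cyc_axes
    by (auto simp: vec.neg simp flip: matrix_vector_mul_assoc)
  show "{A \<in> coord_prod_stab. det A = 1} \<subseteq> T_grp"
  proof
    fix A assume A: "A \<in> {A \<in> coord_prod_stab. det A = 1}"
    obtain i where "A *v e3 = axis i 1 \<or> A *v e3 = - axis i 1"
      using stab_permutes_axes A by blast
    then show "A \<in> T_grp" using exhaust_3[of i] A 1[of A] 2[of A] 3[of A] by auto
  qed
qed (rule T_grp_subset)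

text \<open>The fixed rotoinversion lies in the stabiliser and has determinant \<open>-1\<close>, so the second coset
  consists of the elements of determinant \<open>-1\<close>.\<close>
lemma O_minus_eq_stab: "O_minus = coord_prod_stab"
proof
  let ?t = "- rot e3 (pi / 2)"
  show "O_minus \<subseteq> coord_prod_stab"
    using stab_mult[OF roto_quarter_in_stab] by (auto simp: O_minus_def l_coset_def T_grp_eq)
  show "coord_prod_stab \<subseteq> O_minus"
  proof
    fix A assume A: "A \<in> coord_prod_stab"
    then have o: "orthogonal_matrix A" by (simp add: coord_prod_stab_def)
    have ot: "orthogonal_matrix ?t" using roto_quarter_in_stab by (simp add: coord_prod_stab_def)
    show "A \<in> O_minus"
    proof (cases "det A = 1")
      case True
      then show ?thesis using A by (simp add: O_minus_def T_grp_eq)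
    next
      case False
      then have "det A = - 1" using det_orthogonal_matrix[OF o] by auto
      moreover have "det ?t = - 1"
        using det_rot[OF axis_nonzero, of 3 "pi / 2"] by (simp add: det_3)
      ultimately have "transpose ?t ** A \<in> T_grp"
        using A by (simp add: T_grp_eq stab_mult stab_transpose roto_quarter_in_stab det_mul det_transpose)
      moreover have "A = ?t ** (transpose ?t ** A)"
        using ot by (metis matrix_mul_assoc matrix_mul_lid orthogonal_matrix_def)
      ultimately show ?thesis unfolding O_minus_def l_coset_def mult_O3 by blast
    qed
  qed
qed

section \<open>Sets of rotations and rotoinversions about one axis\<close>

text \<open>Every group in the theorem other than \<open>O_minus\<close> is of this form. The condition
  \<open>R\<close> on sign and angle is kept separate from the axis because, if it is even in the angle, conjugation changes only the
  axis.\<close>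
definition axial_set :: "real^3 \<Rightarrow> (real \<Rightarrow> real \<Rightarrow> bool) \<Rightarrow> (real^3^3) set" where
  "axial_set n R = {\<epsilon> *\<^sub>R rot n \<theta> |\<epsilon> \<theta>. (\<epsilon> = 1 \<or> \<epsilon> = -1) \<and> R \<epsilon> \<theta>}"

lemma axial_set_split:
  "axial_set n R = {rot n \<theta> |\<theta>. R 1 \<theta>} \<union> {- rot n \<theta> |\<theta>. R (-1) \<theta>}"
proof -
  have "axial_set n R = {1 *\<^sub>R rot n \<theta> |\<theta>. R 1 \<theta>} \<union> {-1 *\<^sub>R rot n \<theta> |\<theta>. R (-1) \<theta>}"
    unfolding axial_set_def by blast
  then show ?thesis by simp
qed

lemma axial_set_cong:
  assumes "\<And>\<epsilon> \<theta>. \<epsilon> = 1 \<or> \<epsilon> = -1 \<Longrightarrow> R \<epsilon> \<theta> \<longleftrightarrow> R' \<epsilon> \<theta>"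
  shows "axial_set n R = axial_set n R'"
  unfolding axial_set_def using assms by blast

lemma axial_set_subset:
  assumes "n \<noteq> 0" shows "axial_set n R \<subseteq> carrier O3"
  using orthogonal_rot[OF assms]
  by (auto simp: axial_set_def orthogonal_matrix_def transpose_def matrix_matrix_mult_def vec_eq_iff)

lemma axial_set_angle_sign:
  assumes even: "\<And>\<epsilon> \<theta>. R \<epsilon> (- \<theta>) \<longleftrightarrow> R \<epsilon> \<theta>" and s: "s = 1 \<or> s = (-1::real)"
  shows "{\<epsilon> *\<^sub>R rot n (s * \<theta>) |\<epsilon> \<theta>. (\<epsilon> = 1 \<or> \<epsilon> = -1) \<and> R \<epsilon> \<theta>} = axial_set n R"
proof -
  have R: "R \<epsilon> (s * \<theta>) \<longleftrightarrow> R \<epsilon> \<theta>" and ss: "s * (s * \<theta>) = \<theta>" for \<epsilon> \<theta>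
    using s even by auto
  show ?thesis
    unfolding axial_set_def
  proof (intro equalityI subsetI)
    fix A assume "A \<in> {\<epsilon> *\<^sub>R rot n (s * \<theta>) |\<epsilon> \<theta>. (\<epsilon> = 1 \<or> \<epsilon> = -1) \<and> R \<epsilon> \<theta>}"
    then show "A \<in> {\<epsilon> *\<^sub>R rot n \<theta> |\<epsilon> \<theta>. (\<epsilon> = 1 \<or> \<epsilon> = -1) \<and> R \<epsilon> \<theta>}"
      using R by blast
  next
    fix A assume "A \<in> {\<epsilon> *\<^sub>R rot n \<theta> |\<epsilon> \<theta>. (\<epsilon> = 1 \<or> \<epsilon> = -1) \<and> R \<epsilon> \<theta>}"
    then obtain \<epsilon> \<theta> where "A = \<epsilon> *\<^sub>R rot n (s * (s * \<theta>))" "\<epsilon> = 1 \<or> \<epsilon> = -1" "R \<epsilon> (s * \<theta>)"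
      unfolding R ss by blast
    then show "A \<in> {\<epsilon> *\<^sub>R rot n (s * \<theta>) |\<epsilon> \<theta>. (\<epsilon> = 1 \<or> \<epsilon> = -1) \<and> R \<epsilon> \<theta>}"
      by blast
  qed
qed

text \<open>Evenness of \<open>R\<close> in the angle is what makes a conjugation by a matrix of determinant \<open>-1\<close>
  harmless.\<close>
lemma conjugate_axial_set:
  assumes g: "orthogonal_matrix g" and even: "\<And>\<epsilon> \<theta>. R \<epsilon> (- \<theta>) \<longleftrightarrow> R \<epsilon> \<theta>"
  shows "conjugate g (axial_set n R) = axial_set (g *v n) R"
proof -
  have dg: "det g = 1 \<or> det g = -1" using det_orthogonal_matrix[OF g] by auto
  have conj: "g ** (\<epsilon> *\<^sub>R rot n \<theta>) ** transpose g = \<epsilon> *\<^sub>R rot (g *v n) (det g * \<theta>)" for \<epsilon> \<theta>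
    using rot_conj[OF g, of n \<theta>] by (simp add: matrix_scalar_ac flip: scalar_matrix_assoc)
  have "conjugate g (axial_set n R) =
      {\<epsilon> *\<^sub>R rot (g *v n) (det g * \<theta>) |\<epsilon> \<theta>. (\<epsilon> = 1 \<or> \<epsilon> = -1) \<and> R \<epsilon> \<theta>}"
    unfolding conjugate_image inv_O3[OF g] mult_O3 axial_set_def conj[symmetric] by blast
  also have "\<dots> = axial_set (g *v n) R"
    using even dg by (rule axial_set_angle_sign)
  finally show ?thesis .
qed

lemma axial_set_scaleR:
  assumes k: "k \<noteq> 0" and even: "\<And>\<epsilon> \<theta>. R \<epsilon> (- \<theta>) \<longleftrightarrow> R \<epsilon> \<theta>"
  shows "axial_set (k *\<^sub>R n) R = axial_set n R"
proof -
  have "sgn k = 1 \<or> sgn k = -1" using k by (auto simp: sgn_real_def)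
  then show ?thesis
    using axial_set_angle_sign[where R = R, OF even, of "sgn k" n] unfolding axial_set_def rot_scaleR[OF k] by simp
qed

lemma orthogonal_matrix_maps_e3_to_axis:
  assumes "n \<noteq> 0"
  obtains g k where "orthogonal_matrix g" "k \<noteq> 0" "n = k *\<^sub>R (g *v e3)"
proof -
  have "norm (n /\<^sub>R norm n) = 1" using assms by simp
  then obtain g where "orthogonal_matrix g" "g *v e3 = n /\<^sub>R norm n"
    using orthogonal_matrix_exists_basis by metis
  with assms show ?thesis by (intro that[of g "norm n"]) auto
qed

lemma conj_class_axial_set:
  assumes "n \<noteq> 0" and even: "\<And>\<epsilon> \<theta>. R \<epsilon> (- \<theta>) \<longleftrightarrow> R \<epsilon> \<theta>"
  shows "conj_class (axial_set n R) = conj_class (axial_set e3 R)"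
proof -
  obtain g k where "orthogonal_matrix g" "k \<noteq> 0" "n = k *\<^sub>R (g *v e3)"
    using orthogonal_matrix_maps_e3_to_axis[OF assms(1)] .
  then have "axial_set n R = conjugate g (axial_set e3 R)"
    using even by (simp add: axial_set_scaleR conjugate_axial_set)
  with \<open>orthogonal_matrix g\<close> show ?thesis
    by (simp add: conj_class_conjugate axial_set_subset axis_nonzero del: mult_O3)
qed

lemma trivial_grp_axial: "trivial_grp = axial_set n (\<lambda>\<epsilon> \<theta>. \<epsilon> = 1 \<and> cos \<theta> = 1)"
proof -
  have "{rot n \<theta> |\<theta>. cos \<theta> = 1} = {mat 1}"
    by (auto simp: rot_trivial) (metis cos_zero rot_trivial)
  then show ?thesis by (simp add: axial_set_split trivial_grp_def)
qed

text \<open>Angles modulo \<open>2 \<pi>\<close> whose \<open>k\<close>-fold multiple is trivial are described by a cosine equation, which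
  avoids choosing representatives \<open>2 \<pi> j / k\<close> with \<open>j < k\<close>.\<close>
lemma Z_grp_axial:
  assumes "k \<ge> 1"
  shows "Z_grp k = axial_set e3 (\<lambda>\<epsilon> \<theta>. \<epsilon> = 1 \<and> cos (real k * \<theta>) = 1)"
proof (intro equalityI subsetI)
  fix A assume "A \<in> Z_grp k"
  then obtain j where "j < k" and A: "A = rot e3 (2 * real j * pi / real k)"
    by (auto simp: Z_grp_def)
  then have "cos (real k * (2 * real j * pi / real k)) = 1"
    using cos_one_2pi_int[of "2 * real j * pi"] by (auto simp: mult_ac intro: exI[of _ "int j"])
  with A show "A \<in> axial_set e3 (\<lambda>\<epsilon> \<theta>. \<epsilon> = 1 \<and> cos (real k * \<theta>) = 1)"
    unfolding axial_set_split by blast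
next
  fix A assume "A \<in> axial_set e3 (\<lambda>\<epsilon> \<theta>. \<epsilon> = 1 \<and> cos (real k * \<theta>) = 1)"
  then obtain \<theta> where A: "A = rot e3 \<theta>" and c: "cos (real k * \<theta>) = 1"
    by (auto simp: axial_set_split)
  then obtain n :: int where n: "real k * \<theta> = of_int n * 2 * pi" by (auto simp: cos_one_2pi_int)
  define j where "j = nat (n mod int k)"
  have "j < k" using assms by (simp add: j_def nat_less_iff)
  have "n = int k * (n div int k) + int j" using assms by (simp add: j_def)
  then have "real_of_int n = real k * of_int (n div int k) + real j"
    by (metis of_int_add of_int_mult of_int_of_nat_eq)
  with n assms have "\<theta> = 2 * real j * pi / real k + 2 * pi * of_int (n div int k)"
    by (simp add: field_simps)
  then have "sin \<theta> = sin (2 * real j * pi / real k) \<and> cos \<theta> = cos (2 * real j * pi / real k)"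
    unfolding sin_cos_eq_iff by blast
  then have "A = rot e3 (2 * real j * pi / real k)" using A rot_cong by metis
  with \<open>j < k\<close> show "A \<in> Z_grp k" by (auto simp: Z_grp_def)
qed

lemma plus_Z2c_Z_grp_axial:
  assumes "k \<ge> 1"
  shows "plus_Z2c (Z_grp k) = axial_set e3 (\<lambda>\<epsilon> \<theta>. cos (real k * \<theta>) = 1)"
proof -
  have "Z_grp k = {rot e3 \<theta> |\<theta>. cos (real k * \<theta>) = 1}"
    by (simp add: Z_grp_axial[OF assms] axial_set_split)
  then have Z: "Z_grp k = (rot e3) ` {\<theta>. cos (real k * \<theta>) = 1}" by auto
  show ?thesis
    unfolding plus_Z2c_def axial_set_split Z image_image setcompr_eq_image ..
qed

text \<open>The shift by \<open>\<pi> / k\<close> changes the sign of \<open>cos k\<theta>\<close>, so in the coset the cosine is \<open>-1\<close>, which is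
  also the sign of the matrices.\<close>
lemma Z_minus_axial:
  assumes "k \<ge> 1"
  shows "Z_minus (2 * k) = axial_set e3 (\<lambda>\<epsilon> \<theta>. cos (real k * \<theta>) = \<epsilon>)"
proof -
  have shift: "cos (real k * (pi / real k + \<theta>)) = - cos (real k * \<theta>)" for \<theta>
    using assms by (simp add: distrib_left)
  have mult: "(- rot e3 (pi / real k)) ** rot e3 \<theta> = - rot e3 (pi / real k + \<theta>)" for \<theta>
    unfolding rot_add[OF axis_nonzero, symmetric]
    by (simp add: matrix_matrix_mult_def vec_eq_iff sum_negf)
  have "2 * k \<noteq> 1" by presburger
  then have Z: "Z_minus (2 * k) = Z_grp k \<union> ((- rot e3 (pi / real k)) <#\<^bsub>O3\<^esub> Z_grp k)"
    by (simp add: Z_minus_def)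
  have Zg: "Z_grp k = {rot e3 \<theta> |\<theta>. cos (real k * \<theta>) = 1}"
    by (simp add: Z_grp_axial[OF assms] axial_set_split)
  have coset: "(- rot e3 (pi / real k)) <#\<^bsub>O3\<^esub> Z_grp k = {- rot e3 \<theta> |\<theta>. cos (real k * \<theta>) = - 1}"
  proof (intro equalityI subsetI)
    fix A assume "A \<in> (- rot e3 (pi / real k)) <#\<^bsub>O3\<^esub> Z_grp k"
    then show "A \<in> {- rot e3 \<theta> |\<theta>. cos (real k * \<theta>) = - 1}"
      unfolding l_coset_def mult_O3 Zg by (clarsimp simp: mult) (metis shift)
  next
    fix A assume "A \<in> {- rot e3 \<theta> |\<theta>. cos (real k * \<theta>) = - 1}"
    then obtain \<theta> where "A = - rot e3 \<theta>" "cos (real k * \<theta>) = - 1" by auto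
    then have "A = (- rot e3 (pi / real k)) ** rot e3 (\<theta> - pi / real k)"
      "cos (real k * (\<theta> - pi / real k)) = 1"
      using shift[of "\<theta> - pi / real k"] by (simp_all add: mult)
    then show "A \<in> (- rot e3 (pi / real k)) <#\<^bsub>O3\<^esub> Z_grp k"
      unfolding l_coset_def mult_O3 Zg by blast
  qed
  show ?thesis unfolding Z coset unfolding Zg axial_set_split ..
qed

section \<open>Arithmetic of angles\<close>

text \<open>Bezout's identity for the multiples of \<open>\<theta>\<close> that are trivial modulo \<open>2 \<pi>\<close>.\<close>
lemma cos_multiple_gcd:
  "cos (real a * \<theta>) = 1 \<and> cos (real b * \<theta>) = 1 \<longleftrightarrow> cos (real (gcd a b) * \<theta>) = 1"
proof
  assume "cos (real a * \<theta>) = 1 \<and> cos (real b * \<theta>) = 1"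
  then obtain p q :: int where pq: "real a * \<theta> = of_int p * 2 * pi" "real b * \<theta> = of_int q * 2 * pi"
    by (auto simp: cos_one_2pi_int)
  obtain u v :: int where "u * int a + v * int b = gcd (int a) (int b)"
    using bezout_int by blast
  then have "real (gcd a b) = of_int u * real a + of_int v * real b"
    by (metis gcd_int_int_eq of_int_add of_int_mult of_int_of_nat_eq)
  then have "real (gcd a b) * \<theta> = of_int u * (real a * \<theta>) + of_int v * (real b * \<theta>)"
    by (simp add: algebra_simps)
  also have "\<dots> = of_int (u * p + v * q) * 2 * pi"
    unfolding pq by (simp add: algebra_simps)
  finally show "cos (real (gcd a b) * \<theta>) = 1" unfolding cos_one_2pi_int by blast
next
  assume "cos (real (gcd a b) * \<theta>) = 1"
  then obtain p :: int where p: "real (gcd a b) * \<theta> = of_int p * 2 * pi"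
    by (auto simp: cos_one_2pi_int)
  have "cos (real c * \<theta>) = 1" if dvd: "gcd a b dvd c" for c
  proof -
    obtain l where "c = gcd a b * l" using dvd by (elim dvdE)
    then have "real c * \<theta> = real l * (real (gcd a b) * \<theta>)" by simp
    also have "\<dots> = of_int (int l * p) * 2 * pi" unfolding p by simp
    finally show ?thesis unfolding cos_one_2pi_int by blast
  qed
  then show "cos (real a * \<theta>) = 1 \<and> cos (real b * \<theta>) = 1" by simp
qed

lemma cos_multiple_dvd: "cos (real a * \<theta>) = 1 \<Longrightarrow> a dvd b \<Longrightarrow> cos (real b * \<theta>) = 1"
  using cos_multiple_gcd[of a \<theta> b] by simp

text \<open>Such an angle is an odd multiple of \<open>\<pi> / 2 ^ i\<close>, hence of order divisible by \<open>2 ^ Suc i\<close> modulo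
  \<open>2 \<pi>\<close>.\<close>
lemma dvd_of_cos_minus_one:
  assumes "cos (2 ^ i * \<theta>) = -1" "cos (real m * \<theta>) = 1"
  shows "2 ^ Suc i dvd m"
proof -
  have "cos (2 ^ i * \<theta> + pi) = 1" using assms(1) by simp
  then obtain l :: int where "2 ^ i * \<theta> + pi = of_int l * 2 * pi" unfolding cos_one_2pi_int by blast
  then have l: "2 ^ i * \<theta> = of_int (2 * l - 1) * pi" by (simp add: algebra_simps)
  obtain n :: int where n: "real m * \<theta> = of_int n * 2 * pi"
    using assms(2) unfolding cos_one_2pi_int by blast
  have "real m * (of_int (2 * l - 1) * pi) = 2 ^ i * (of_int n * 2 * pi)"
    unfolding l[symmetric] n[symmetric] by simp
  then have "real m * of_int (2 * l - 1) = 2 ^ i * (2 * of_int n)" by simp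
  then have "real_of_int (int m * (2 * l - 1)) = of_int (2 ^ Suc i * n)" by simp
  then have "int m * (2 * l - 1) = 2 ^ Suc i * n" by (simp only: of_int_eq_iff)
  then have "2 ^ Suc i dvd int m * (2 * l - 1)" by simp
  moreover have "coprime (2 ^ Suc i) (2 * l - 1)"
    unfolding coprime_power_left_iff by simp
  ultimately have "2 ^ Suc i dvd int m" by (simp only: coprime_dvd_mult_left_iff)
  then have "int (2 ^ Suc i) dvd int m" by simp
  then show ?thesis by (simp only: int_dvd_int_iff)
qed

section \<open>Intersections on the three reference axes\<close>

lemma stab_Int_axial_set:
  assumes "\<And>\<epsilon> \<theta>. \<epsilon> = 1 \<or> \<epsilon> = -1 \<Longrightarrow> \<epsilon> *\<^sub>R rot n \<theta> \<in> coord_prod_stab \<longleftrightarrow> Q \<epsilon> \<theta>"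
  shows "coord_prod_stab \<inter> axial_set n R = axial_set n (\<lambda>\<epsilon> \<theta>. R \<epsilon> \<theta> \<and> Q \<epsilon> \<theta>)"
  using assms[of 1] assms[of "-1"] by (auto simp: axial_set_split)

text \<open>The conjugate of \<open>plus_Z2c (Z_grp m)\<close> with axis \<open>n\<close>, for \<open>n \<noteq> 0\<close> and \<open>m \<ge> 1\<close>.\<close>
definition axial_group :: "nat \<Rightarrow> real^3 \<Rightarrow> (real^3^3) set" where
  "axial_group m n = axial_set n (\<lambda>\<epsilon> \<theta>. cos (real m * \<theta>) = 1)"

text \<open>If \<open>4\<close> divides \<open>m\<close>, the condition \<open>cos m\<theta> = 1\<close> follows from \<open>cos 2\<theta> = \<plusminus> 1\<close>. Otherwise it excludes
  \<open>cos 2\<theta> = -1\<close>, so only proper rotations remain.\<close>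
lemma stab_Int_axial_e3:
  assumes "m \<ge> 1"
  shows "coord_prod_stab \<inter> axial_group m e3 = (if 4 dvd m then Z_minus 4 else Z_grp (gcd 2 m))"
proof -
  have *: "coord_prod_stab \<inter> axial_group m e3 = axial_set e3 (\<lambda>\<epsilon> \<theta>. cos (real m * \<theta>) = 1 \<and> cos (2 * \<theta>) = \<epsilon>)"
    unfolding axial_group_def by (rule stab_Int_axial_set) (rule e3_rot_in_stab_iff)
  show ?thesis
  proof (cases "4 dvd m")
    case True
    have "cos (real m * \<theta>) = 1" if "cos (2 * \<theta>) = 1 \<or> cos (2 * \<theta>) = -1" for \<theta>
    proof -
      have "cos (2 * (2 * \<theta>)) = 1" using that unfolding cos_double_cos[of "2 * \<theta>"] by auto
      then have "cos (real 4 * \<theta>) = 1" by simp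
      then show ?thesis using True by (rule cos_multiple_dvd)
    qed
    then have "coord_prod_stab \<inter> axial_group m e3 = axial_set e3 (\<lambda>\<epsilon> \<theta>. cos (2 * \<theta>) = \<epsilon>)"
      unfolding * by (intro axial_set_cong) auto
    then show ?thesis using True Z_minus_axial[of 2] by simp
  next
    case False
    have "cos (2 * \<theta>) = -1 \<Longrightarrow> cos (real m * \<theta>) \<noteq> 1" for \<theta>
      using dvd_of_cos_minus_one[of 1 \<theta> m] False by auto
    moreover have "cos (2 * \<theta>) = 1 \<and> cos (real m * \<theta>) = 1 \<longleftrightarrow> cos (real (gcd 2 m) * \<theta>) = 1" for \<theta>
      using cos_multiple_gcd[of 2 \<theta> m] by simp
    ultimately have "coord_prod_stab \<inter> axial_group m e3
        = axial_set e3 (\<lambda>\<epsilon> \<theta>. \<epsilon> = 1 \<and> cos (real (gcd 2 m) * \<theta>) = 1)"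
      unfolding * by (intro axial_set_cong) blast
    moreover have "gcd 2 m \<ge> 1" by (simp add: Suc_le_eq)
    ultimately show ?thesis using False Z_grp_axial[of "gcd 2 m"] by simp
  qed
qed

lemma stab_Int_axial_body_diagonal:
  "conj_class (coord_prod_stab \<inter> axial_group m body_diagonal) = conj_class (Z_grp (gcd 3 m))"
proof -
  have "coord_prod_stab \<inter> axial_group m body_diagonal
      = axial_set body_diagonal (\<lambda>\<epsilon> \<theta>. cos (real m * \<theta>) = 1 \<and> \<epsilon> = 1 \<and> cos (3 * \<theta>) = 1)"
    unfolding axial_group_def by (rule stab_Int_axial_set) (rule body_diagonal_rot_in_stab_iff)
  also have "\<dots> = axial_set body_diagonal (\<lambda>\<epsilon> \<theta>. \<epsilon> = 1 \<and> cos (real (gcd 3 m) * \<theta>) = 1)"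
  proof (intro axial_set_cong)
    show "cos (real m * \<theta>) = 1 \<and> \<epsilon> = 1 \<and> cos (3 * \<theta>) = 1 \<longleftrightarrow> \<epsilon> = 1 \<and> cos (real (gcd 3 m) * \<theta>) = 1"
      for \<epsilon> \<theta> using cos_multiple_gcd[of 3 \<theta> m] by auto
  qed
  finally have "coord_prod_stab \<inter> axial_group m body_diagonal
      = axial_set body_diagonal (\<lambda>\<epsilon> \<theta>. \<epsilon> = 1 \<and> cos (real (gcd 3 m) * \<theta>) = 1)" .
  moreover have "conj_class (axial_set body_diagonal (\<lambda>\<epsilon> \<theta>. \<epsilon> = 1 \<and> cos (real (gcd 3 m) * \<theta>) = 1))
      = conj_class (axial_set e3 (\<lambda>\<epsilon> \<theta>. \<epsilon> = 1 \<and> cos (real (gcd 3 m) * \<theta>) = 1))"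
    by (rule conj_class_axial_set[OF body_diagonal_nonzero]) simp
  moreover have "gcd 3 m \<ge> 1" by (simp add: Suc_le_eq)
  ultimately show ?thesis by (simp add: Z_grp_axial)
qed

text \<open>The only candidate besides the identity is the reflection \<open>- rot n \<pi>\<close>, which needs \<open>m\<close> even. For
  odd \<open>m\<close> the right-hand side is the class of \<open>Z_minus 1\<close>, which is the trivial group.\<close>
lemma stab_Int_axial_face_diagonal:
  "conj_class (coord_prod_stab \<inter> axial_group m face_diagonal) = conj_class (Z_minus (gcd 2 m))"
proof -
  have *: "coord_prod_stab \<inter> axial_group m face_diagonal
      = axial_set face_diagonal (\<lambda>\<epsilon> \<theta>. cos (real m * \<theta>) = 1 \<and> cos \<theta> = \<epsilon>)"
    unfolding axial_group_def by (rule stab_Int_axial_set) (rule face_diagonal_rot_in_stab_iff)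
  show ?thesis
  proof (cases "even m")
    case True
    have "cos (real m * \<theta>) = 1" if "cos \<theta> = 1 \<or> cos \<theta> = -1" for \<theta>
    proof -
      have "cos (real 2 * \<theta>) = 1" using that unfolding of_nat_numeral cos_double_cos by auto
      then show ?thesis using True by (rule cos_multiple_dvd)
    qed
    then have "coord_prod_stab \<inter> axial_group m face_diagonal = axial_set face_diagonal (\<lambda>\<epsilon> \<theta>. cos \<theta> = \<epsilon>)"
      unfolding * by (intro axial_set_cong) auto
    moreover have "conj_class (axial_set face_diagonal (\<lambda>\<epsilon> \<theta>. cos \<theta> = \<epsilon>))
        = conj_class (axial_set e3 (\<lambda>\<epsilon> \<theta>. cos \<theta> = \<epsilon>))"
      by (rule conj_class_axial_set[OF face_diagonal_nonzero]) simp
    ultimately show ?thesis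
      using True Z_minus_axial[of 1] by (simp add: gcd_nat.absorb1)
  next
    case False
    have "coord_prod_stab \<inter> axial_group m face_diagonal = axial_set face_diagonal (\<lambda>\<epsilon> \<theta>. \<epsilon> = 1 \<and> cos \<theta> = 1)"
    proof -
      have "cos \<theta> = -1 \<Longrightarrow> cos (real m * \<theta>) \<noteq> 1" "cos \<theta> = 1 \<Longrightarrow> cos (real m * \<theta>) = 1" for \<theta>
        using dvd_of_cos_minus_one[of 0 \<theta> m] False cos_multiple_dvd[of 1 \<theta> m] by auto
      then show ?thesis unfolding * by (intro axial_set_cong) blast
    qed
    also have "\<dots> = trivial_grp" by (rule trivial_grp_axial[symmetric])
    moreover have "gcd 2 m = 1" using False by (simp add: coprime_iff_gcd_eq_1[symmetric])
    ultimately show ?thesis by (simp add: Z_minus_def)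
  qed
qed


section \<open>Axes of nontrivial elements of the stabiliser\<close>

text \<open>The scalar \<open>k\<close> makes this a property of the line spanned by \<open>u\<close>: it is the image of a reference
  axis under the stabiliser.\<close>
definition on_tetrahedral_axis :: "real^3 \<Rightarrow> bool" where
  "on_tetrahedral_axis u \<longleftrightarrow> (\<exists>h\<in>coord_prod_stab. \<exists>k. k \<noteq> 0 \<and>
     (\<exists>a\<in>{e3, body_diagonal, face_diagonal}. u = k *\<^sub>R (h *v a)))"

lemma on_tetrahedral_axis_stab:
  assumes "A \<in> coord_prod_stab" "on_tetrahedral_axis (A *v u)"
  shows "on_tetrahedral_axis u"
proof -
  obtain h k a where *: "h \<in> coord_prod_stab" "k \<noteq> 0" "a \<in> {e3, body_diagonal, face_diagonal}"
    "A *v u = k *\<^sub>R (h *v a)"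
    using assms(2) unfolding on_tetrahedral_axis_def by blast
  have "u = transpose A *v (A *v u)"
    using assms(1) by (simp only: matrix_vector_mul_assoc) (simp add: coord_prod_stab_def orthogonal_matrix)
  also have "\<dots> = k *\<^sub>R ((transpose A ** h) *v a)"
    unfolding * by (simp only: matrix_vector_mult_scaleR matrix_vector_mul_assoc)
  finally have "u = k *\<^sub>R ((transpose A ** h) *v a)" .
  moreover have "transpose A ** h \<in> coord_prod_stab"
    using assms(1) *(1) by (intro stab_mult stab_transpose)
  ultimately show ?thesis
    unfolding on_tetrahedral_axis_def using *(2,3) by blast
qed

lemma on_tetrahedral_axisI:
  assumes "k \<noteq> 0" "a \<in> {e3, body_diagonal, face_diagonal}"
  shows "on_tetrahedral_axis (k *\<^sub>R a)"
proof -
  have "k *\<^sub>R a = k *\<^sub>R (mat 1 *v a)" by simp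
  with assms stab_one show ?thesis unfolding on_tetrahedral_axis_def by blast
qed

lemma on_tetrahedral_axis_cyc:
  assumes "on_tetrahedral_axis (vector [u$3, u$1, u$2])"
  shows "on_tetrahedral_axis u"
  using on_tetrahedral_axis_stab[OF cyc_in_stab] assms by (simp add: cyc_apply)

lemma on_tetrahedral_axis_coordinate:
  assumes "u \<noteq> 0" "coord_grad u = 0"
  shows "on_tetrahedral_axis u"
proof -
  have base: "on_tetrahedral_axis v" if "v$1 = 0" "v$2 = 0" "v$3 \<noteq> 0" for v
  proof -
    have "v = v$3 *\<^sub>R e3" using that by (simp add: vec_eq_iff forall_3 axis_def)
    with on_tetrahedral_axisI[of "v$3" e3] that show ?thesis by simp
  qed
  have "u$2 * u$3 = 0" "u$1 * u$3 = 0" "u$1 * u$2 = 0"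
    using assms(2) by (simp_all add: coord_grad_def vec_eq_iff forall_3)
  moreover have "u$1 \<noteq> 0 \<or> u$2 \<noteq> 0 \<or> u$3 \<noteq> 0"
    using assms(1) by (simp add: vec_eq_iff forall_3)
  ultimately consider "u$1 = 0" "u$2 = 0" "u$3 \<noteq> 0" | "u$1 = 0" "u$3 = 0" "u$2 \<noteq> 0"
    | "u$2 = 0" "u$3 = 0" "u$1 \<noteq> 0" by auto
  then show ?thesis
  proof cases
    case 1 then show ?thesis by (rule base)
  next
    case 2 then show ?thesis by (intro on_tetrahedral_axis_cyc[OF base]) simp_all
  next
    case 3 then show ?thesis by (intro on_tetrahedral_axis_cyc[OF on_tetrahedral_axis_cyc[OF base]]) simp_all
  qed
qed

text \<open>After division by the first coordinate only the four sign patterns of the other two remain. The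
  half turn about \<open>e3\<close> removes the pattern \<open>(1,1,-1)\<close>, and the cyclic permutation reduces the other
  two to it; the product of the signs may be negative, since the line has no orientation.\<close>
lemma on_tetrahedral_axis_body_diagonal:
  assumes "u \<noteq> 0" "(u$1)\<^sup>2 = (u$2)\<^sup>2" "(u$1)\<^sup>2 = (u$3)\<^sup>2"
  shows "on_tetrahedral_axis u"
proof -
  have base: "on_tetrahedral_axis v" if "v$2 = v$1" "v$3 = v$1" "v$1 \<noteq> 0" for v
  proof -
    have "v = v$1 *\<^sub>R body_diagonal" using that by (simp add: vec_eq_iff forall_3 axis_def body_diagonal_def)
    with on_tetrahedral_axisI[of "v$1" body_diagonal] that show ?thesis by simp
  qed
  have flip: "on_tetrahedral_axis v" if "v$2 = v$1" "v$3 = - v$1" "v$1 \<noteq> 0" for v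
    using that by (intro on_tetrahedral_axis_stab[OF half_turn_in_stab base]) (simp_all add: rot_e3_apply)
  have "u$1 \<noteq> 0" using assms by (auto simp: vec_eq_iff forall_3)
  moreover have "u$2 = u$1 \<or> u$2 = - u$1" "u$3 = u$1 \<or> u$3 = - u$1"
    using assms(2,3) by (auto simp: power2_eq_iff)
  ultimately consider "u$2 = u$1 \<and> u$3 = u$1" | "u$2 = u$1 \<and> u$3 = - u$1"
    | "u$2 = - u$1 \<and> u$3 = u$1" | "u$2 = - u$1 \<and> u$3 = - u$1" by blast
  then show ?thesis
  proof cases
    case 1 with \<open>u$1 \<noteq> 0\<close> show ?thesis by (intro base) simp_all
  next
    case 2 with \<open>u$1 \<noteq> 0\<close> show ?thesis by (intro flip) simp_all
  next
    case 3 with \<open>u$1 \<noteq> 0\<close> show ?thesis by (intro on_tetrahedral_axis_cyc[OF flip]) simp_all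
  next
    case 4 with \<open>u$1 \<noteq> 0\<close> show ?thesis
      by (intro on_tetrahedral_axis_cyc[OF on_tetrahedral_axis_cyc[OF flip]]) simp_all
  qed
qed

text \<open>The rotoinversion by a quarter turn about \<open>e3\<close> exchanges the two diagonals of the horizontal
  face.\<close>
lemma on_tetrahedral_axis_face_diagonal:
  assumes "u \<noteq> 0" "u$3 = 0" "(u$1)\<^sup>2 = (u$2)\<^sup>2"
  shows "on_tetrahedral_axis u"
proof -
  have base: "on_tetrahedral_axis v" if "v$2 = v$1" "v$3 = 0" "v$1 \<noteq> 0" for v
  proof -
    have "v = v$1 *\<^sub>R face_diagonal" using that by (simp add: vec_eq_iff forall_3 axis_def face_diagonal_def)
    with on_tetrahedral_axisI[of "v$1" face_diagonal] that show ?thesis by simp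
  qed
  have "- rot e3 (pi / 2) *v u = - (rot e3 (pi / 2) *v u)"
    by (metis scaleR_minus1_left scaleR_matrix_vector_assoc)
  then have t: "- rot e3 (pi / 2) *v u = vector [u$2, - u$1, - u$3]"
    by (simp add: rot_e3_apply vec_eq_iff forall_3)
  have "u$1 \<noteq> 0" using assms by (auto simp: vec_eq_iff forall_3)
  moreover have "u$2 = u$1 \<or> u$2 = - u$1"
    using assms(3) by (auto simp: power2_eq_iff)
  ultimately show ?thesis
    using base[of u] on_tetrahedral_axis_stab[OF roto_quarter_in_stab, of u] base[of "vector [u$2, - u$1, - u$3]"] assms(2)
    unfolding t by auto
qed

text \<open>The same lines described by equations: coordinate axes, body diagonals and face diagonals of
  the cube. This form is the one that comes out of the invariance argument, and it is easily refuted
  for a given vector.\<close>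
definition tetrahedral_coords :: "real^3 \<Rightarrow> bool" where
  "tetrahedral_coords u \<longleftrightarrow> coord_grad u = 0 \<or>
     (u$1)\<^sup>2 = (u$2)\<^sup>2 \<and> (u$1)\<^sup>2 = (u$3)\<^sup>2 \<or>
     u$3 = 0 \<and> (u$1)\<^sup>2 = (u$2)\<^sup>2 \<or> u$2 = 0 \<and> (u$1)\<^sup>2 = (u$3)\<^sup>2 \<or> u$1 = 0 \<and> (u$2)\<^sup>2 = (u$3)\<^sup>2"

lemma tetrahedral_coords_scaleR:
  assumes "k \<noteq> 0"
  shows "tetrahedral_coords (k *\<^sub>R u) \<longleftrightarrow> tetrahedral_coords u"
  using assms
  by (simp add: tetrahedral_coords_def coord_grad_def vec_eq_iff forall_3 power_mult_distrib)

lemma on_tetrahedral_axis_coords: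
  assumes "u \<noteq> 0" "tetrahedral_coords u"
  shows "on_tetrahedral_axis u"
proof -
  have 1: "vector [u$3, u$1, u$2] \<noteq> (0::real^3)" and 2: "vector [u$2, u$3, u$1] \<noteq> (0::real^3)"
    using assms(1) by (auto simp: vec_eq_iff[of u] forall_3 vec_eq_iff[of "vector _"])
  consider "coord_grad u = 0" | "(u$1)\<^sup>2 = (u$2)\<^sup>2" "(u$1)\<^sup>2 = (u$3)\<^sup>2"
    | "u$3 = 0" "(u$1)\<^sup>2 = (u$2)\<^sup>2" | "u$2 = 0" "(u$1)\<^sup>2 = (u$3)\<^sup>2" | "u$1 = 0" "(u$2)\<^sup>2 = (u$3)\<^sup>2"
    using assms(2) unfolding tetrahedral_coords_def by blast
  then show ?thesis
  proof cases
    case 1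
    with assms(1) show ?thesis by (rule on_tetrahedral_axis_coordinate)
  next
    case 2
    with assms(1) show ?thesis by (rule on_tetrahedral_axis_body_diagonal)
  next
    case 3
    with assms(1) show ?thesis by (rule on_tetrahedral_axis_face_diagonal)
  next
    case 4
    show ?thesis
      by (rule on_tetrahedral_axis_cyc, rule on_tetrahedral_axis_face_diagonal) (use 1 4 in simp_all)
  next
    case 5
    show ?thesis
      by (rule on_tetrahedral_axis_cyc, rule on_tetrahedral_axis_cyc, rule on_tetrahedral_axis_face_diagonal)
        (use 2 5 in simp_all)
  qed
qed

text \<open>The gradient \<open>q\<close> of the form at the axis vector \<open>u\<close> is fixed, because the gradient of a cubic
  form is quadratic and so does not see the sign of \<open>A u = \<plusminus> u\<close>. For a proper rotation \<open>q\<close> is then a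
  multiple of \<open>u\<close>, and \<open>u\<^sub>i q\<^sub>i = u\<^sub>1 u\<^sub>2 u\<^sub>3\<close> for all \<open>i\<close> makes the squares \<open>u\<^sub>i\<^sup>2\<close> equal or \<open>q\<close> zero. For a
  rotoinversion \<open>q\<close> is orthogonal to \<open>u\<close>, and if \<open>q \<noteq> 0\<close> the matrix is a reflection and one coordinate
  of \<open>u\<close> vanishes.\<close>
lemma coordinates_of_stab_axis:
  assumes A: "\<epsilon> *\<^sub>R rot u \<theta> \<in> coord_prod_stab" and \<epsilon>: "\<epsilon> = 1 \<or> \<epsilon> = -1"
    and u: "norm u = 1" and nontriv: "\<epsilon> *\<^sub>R rot u \<theta> \<noteq> mat 1"
  shows "tetrahedral_coords u"
proof -
  define q where "q = coord_grad u"
  have uu: "u \<bullet> u = 1" using u by (simp add: norm_eq_1)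
  have app: "(\<epsilon> *\<^sub>R rot u \<theta>) *v v = \<epsilon> *\<^sub>R (cos \<theta> *\<^sub>R v + sin \<theta> *\<^sub>R cross3 u v + ((1 - cos \<theta>) * (u \<bullet> v)) *\<^sub>R u)" for v
    by (simp add: scaleR_matrix_vector_assoc[symmetric] rot_apply_unit[OF u])
  have "(\<epsilon> *\<^sub>R rot u \<theta>) *v u = \<epsilon> *\<^sub>R u"
    unfolding app by (simp add: uu scaleR_left_distrib[symmetric])
  moreover have "coord_grad (\<epsilon> *\<^sub>R u) = q"
    using \<epsilon> by (auto simp: q_def coord_grad_def)
  ultimately have fix_q: "(\<epsilon> *\<^sub>R rot u \<theta>) *v q = q"
    using coord_grad_equivariant[OF A, of u] by (simp add: q_def)
  (* Pairing the fixed vector q with u and with itself turns the fixed point equation into two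
     scalar equations. *)
  have uq: "u \<bullet> q = \<epsilon> * (u \<bullet> q)"
  proof -
    have "u \<bullet> q = u \<bullet> ((\<epsilon> *\<^sub>R rot u \<theta>) *v q)" by (simp add: fix_q)
    also have "\<dots> = \<epsilon> * (u \<bullet> q)"
      unfolding app by (simp add: inner_add_right dot_cross_self uu algebra_simps)
    finally show ?thesis .
  qed
  have qq: "q \<bullet> q = \<epsilon> * (cos \<theta> * (q \<bullet> q) + (1 - cos \<theta>) * (u \<bullet> q)\<^sup>2)"
  proof -
    have "q \<bullet> q = q \<bullet> ((\<epsilon> *\<^sub>R rot u \<theta>) *v q)" by (simp add: fix_q)
    also have "\<dots> = \<epsilon> * (cos \<theta> * (q \<bullet> q) + (1 - cos \<theta>) * (u \<bullet> q)\<^sup>2)"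
      unfolding app by (simp add: inner_add_right dot_cross_self inner_commute[of q u] power2_eq_square)
    finally show ?thesis .
  qed
  have q_coords: "q$1 = u$2 * u$3" "q$2 = u$1 * u$3" "q$3 = u$1 * u$2"
    by (simp_all add: q_def coord_grad_def)
  show ?thesis
  proof (cases "\<epsilon> = 1")
    case True
    have "cos \<theta> \<noteq> 1" using nontriv True rot_trivial by auto
    moreover have "(1 - cos \<theta>) * (q \<bullet> q - (u \<bullet> q)\<^sup>2) = 0"
      using qq True by (simp add: algebra_simps)
    (* This is the equality case of the Cauchy-Schwarz inequality. *)
    ultimately have "q \<bullet> q = (u \<bullet> q)\<^sup>2" by simp
    then have "(q - (u \<bullet> q) *\<^sub>R u) \<bullet> (q - (u \<bullet> q) *\<^sub>R u) = 0"
      by (simp add: inner_diff_left inner_diff_right uu inner_commute[of q u] power2_eq_square)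
    then have q: "q = (u \<bullet> q) *\<^sub>R u" by simp
    show ?thesis
    proof (cases "u \<bullet> q = 0")
      case True
      then show ?thesis using q by (simp add: q_def tetrahedral_coords_def)
    next
      case False
      define l where "l = u \<bullet> q"
      have l: "q$i = l * u$i" for i
        using arg_cong[OF q, of "\<lambda>x. x$i"] by (simp add: l_def)
      have "l * (u$i)\<^sup>2 = u$i * q$i" for i
        unfolding l by (simp add: power2_eq_square)
      then have "l * (u$1)\<^sup>2 = l * (u$2)\<^sup>2" "l * (u$1)\<^sup>2 = l * (u$3)\<^sup>2"
        by (simp_all add: q_coords)
      with False have "(u$1)\<^sup>2 = (u$2)\<^sup>2" "(u$1)\<^sup>2 = (u$3)\<^sup>2" by (simp_all add: l_def)
      then show ?thesis by (simp add: tetrahedral_coords_def)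
    qed
  next
    case False
    then have e: "\<epsilon> = -1" using \<epsilon> by simp
    then have uq0: "u \<bullet> q = 0" using uq by simp
    show ?thesis
    proof (cases "q = 0")
      case True
      then show ?thesis by (simp add: q_def tetrahedral_coords_def)
    next
      case False
      have "(1 + cos \<theta>) * (q \<bullet> q) = 0" using qq e uq0 by (simp add: algebra_simps)
      then have c: "cos \<theta> = -1" using False by simp
      then have "sin \<theta> = 0" using sin_cos_squared_add[of \<theta>] by simp
      then have refl: "(\<epsilon> *\<^sub>R rot u \<theta>) *v v = v - (2 * (u \<bullet> v)) *\<^sub>R u" for v
        unfolding app unfolding e c by simp
      have inv: "coord_prod (v - (2 * (u \<bullet> v)) *\<^sub>R u) = coord_prod v" for v
        using A unfolding coord_prod_stab_def by (simp add: refl)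
      have norm: "(u$1)\<^sup>2 + (u$2)\<^sup>2 + (u$3)\<^sup>2 = 1"
        using uu by (simp add: inner_vec_def sum_3 power2_eq_square)
      have "u$1 * u$2 * u$3 = 0"
        using uq0 q_coords by (simp add: inner_vec_def sum_3 algebra_simps)
      (* In each case the reflection is evaluated at the sum of two basis vectors, one of them
         orthogonal to u. The form vanishes at such a sum. *)
      then consider "u$3 = 0" | "u$2 = 0" | "u$1 = 0" by auto
      then show ?thesis
      proof cases
        case 1
        then have "u$1 * u$2 \<noteq> 0" using False q_coords by (auto simp: vec_eq_iff forall_3)
        moreover have "u$1 * u$2 * (1 - 2 * (u$1)\<^sup>2) = 0"
          using inv[of "vector [1,0,1]"] 1
          by (simp add: coord_prod_def inner_vec_def sum_3 power2_eq_square algebra_simps)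
        ultimately have "(u$1)\<^sup>2 = 1 / 2" by simp
        then show ?thesis using norm 1 by (simp add: tetrahedral_coords_def)
      next
        case 2
        then have "u$1 * u$3 \<noteq> 0" using False q_coords by (auto simp: vec_eq_iff forall_3)
        moreover have "u$1 * u$3 * (1 - 2 * (u$1)\<^sup>2) = 0"
          using inv[of "vector [1,1,0]"] 2
          by (simp add: coord_prod_def inner_vec_def sum_3 power2_eq_square algebra_simps)
        ultimately have "(u$1)\<^sup>2 = 1 / 2" by simp
        then show ?thesis using norm 2 by (simp add: tetrahedral_coords_def)
      next
        case 3
        then have "u$2 * u$3 \<noteq> 0" using False q_coords by (auto simp: vec_eq_iff forall_3)
        moreover have "u$2 * u$3 * (1 - 2 * (u$2)\<^sup>2) = 0"
          using inv[of "vector [1,1,0]"] 3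
          by (simp add: coord_prod_def inner_vec_def sum_3 power2_eq_square algebra_simps)
        ultimately have "(u$2)\<^sup>2 = 1 / 2" by simp
        then show ?thesis using norm 3 by (simp add: tetrahedral_coords_def)
      qed
    qed
  qed
qed

section \<open>The clips operation\<close>

text \<open>Conjugation by \<open>h\<close> fixes the stabiliser and moves the axis, so the class depends only on the
  orbit of the line under the stabiliser.\<close>
lemma axial_group_stab:
  assumes "h \<in> coord_prod_stab" "k \<noteq> 0" "a \<noteq> 0"
  shows "conj_class (coord_prod_stab \<inter> axial_group m (k *\<^sub>R (h *v a)))
    = conj_class (coord_prod_stab \<inter> axial_group m a)"
proof -
  have o: "orthogonal_matrix h" using assms(1) by (simp add: coord_prod_stab_def)
  have "axial_group m (k *\<^sub>R (h *v a)) = conjugate h (axial_group m a)"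
    unfolding axial_group_def using assms(2) by (simp add: axial_set_scaleR conjugate_axial_set[OF o])
  then have "coord_prod_stab \<inter> axial_group m (k *\<^sub>R (h *v a))
      = conjugate h coord_prod_stab \<inter> conjugate h (axial_group m a)"
    by (simp add: conjugate_stab[OF assms(1)])
  also have "\<dots> = conjugate h (coord_prod_stab \<inter> axial_group m a)"
    using o assms(3) by (intro conjugate_Int[symmetric])
      (auto simp: coord_prod_stab_def axial_group_def intro!: axial_set_subset)
  finally show ?thesis
    using o by (simp add: conj_class_conjugate coord_prod_stab_def le_infI1 subset_iff)
qed

lemma stab_Int_axial_group_trivial:
  assumes "u \<noteq> 0" "\<not> tetrahedral_coords u"
  shows "coord_prod_stab \<inter> axial_group m u = trivial_grp"
proof -
  define v where "v = u /\<^sub>R norm u"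
  have v: "norm v = 1" using assms(1) by (simp add: v_def)
  have "tetrahedral_coords v \<longleftrightarrow> tetrahedral_coords u"
    using assms(1) by (simp add: v_def tetrahedral_coords_scaleR)
  then have nt: "\<not> tetrahedral_coords v" using assms(2) by simp
  have "axial_group m u = axial_group m v"
    using assms(1) by (simp add: v_def axial_group_def axial_set_scaleR)
  moreover have "A = mat 1" if A: "A \<in> coord_prod_stab" "A \<in> axial_group m v" for A
  proof -
    obtain \<epsilon> \<theta> where "\<epsilon> = 1 \<or> \<epsilon> = -1" "A = \<epsilon> *\<^sub>R rot v \<theta>"
      using A(2) unfolding axial_group_def axial_set_def by blast
    then show ?thesis using coordinates_of_stab_axis[of \<epsilon> v \<theta>] v nt A(1) by blast
  qed
  moreover have "mat 1 \<in> axial_group m v"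
  proof -
    have "mat 1 = rot v 0" "cos (real m * 0) = 1" by (simp_all add: rot_trivial)
    then show ?thesis unfolding axial_group_def axial_set_split by blast
  qed
  ultimately show ?thesis unfolding trivial_grp_def using stab_one by blast
qed

text \<open>Conjugating the second group amounts to moving its axis, and the orthogonal group acts
  transitively on lines.\<close>
lemma clips_O_minus_plus_Z2c:
  assumes "m \<ge> 1"
  shows "conj_class O_minus \<circledcirc> conj_class (plus_Z2c (Z_grp m))
    = {conj_class (coord_prod_stab \<inter> axial_group m u) |u. u \<noteq> 0}"
proof -
  have "coord_prod_stab \<subseteq> carrier O3" "axial_group m e3 \<subseteq> carrier O3"
    by (auto simp: coord_prod_stab_def axial_group_def intro!: axial_set_subset axis_nonzero)
  then have "conj_class O_minus \<circledcirc> conj_class (plus_Z2c (Z_grp m))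
      = {conj_class (coord_prod_stab \<inter> conjugate g (axial_group m e3)) |g. g \<in> carrier O3}"
    unfolding O_minus_eq_stab plus_Z2c_Z_grp_axial[OF assms] axial_group_def[symmetric]
    by (rule clips_conj_class)
  also have "\<dots> = {conj_class (coord_prod_stab \<inter> axial_group m u) |u. u \<noteq> 0}"
  proof (intro equalityI subsetI)
    fix C assume "C \<in> {conj_class (coord_prod_stab \<inter> conjugate g (axial_group m e3)) |g. g \<in> carrier O3}"
    then obtain g where g: "orthogonal_matrix g"
      and C: "C = conj_class (coord_prod_stab \<inter> conjugate g (axial_group m e3))" by auto
    have "conjugate g (axial_group m e3) = axial_group m (g *v e3)"
      unfolding axial_group_def by (rule conjugate_axial_set[OF g]) simp
    moreover have "g *v e3 \<noteq> 0" using g by (simp add: orthogonal_matrix_eq_0_iff axis_nonzero)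
    ultimately show "C \<in> {conj_class (coord_prod_stab \<inter> axial_group m u) |u. u \<noteq> 0}"
      using C by auto
  next
    fix C assume "C \<in> {conj_class (coord_prod_stab \<inter> axial_group m u) |u. u \<noteq> 0}"
    then obtain u where u: "u \<noteq> 0" and C: "C = conj_class (coord_prod_stab \<inter> axial_group m u)" by auto
    obtain g k where g: "orthogonal_matrix g" "k \<noteq> 0" "u = k *\<^sub>R (g *v e3)"
      using orthogonal_matrix_maps_e3_to_axis[OF u] .
    have "axial_group m u = axial_group m (g *v e3)"
      unfolding g(3) axial_group_def by (rule axial_set_scaleR[OF g(2)]) simp
    also have "\<dots> = conjugate g (axial_group m e3)"
      unfolding axial_group_def by (rule conjugate_axial_set[OF g(1), symmetric]) simp
    finally show "C \<in> {conj_class (coord_prod_stab \<inter> conjugate g (axial_group m e3)) |g. g \<in> carrier O3}"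
      using C g(1) by auto
  qed
  finally show ?thesis .
qed

theorem lemma4p19:
  fixes m d2 d3 :: nat
  assumes "m \<ge> 2"
    and "d2 = gcd 2 m"
    and "d3 = gcd 3 m"
  shows "conj_class O_minus \<circledcirc> conj_class (plus_Z2c (Z_grp m)) =
    (if 4 dvd m
     then {conj_class trivial_grp, conj_class (Z_minus 2), conj_class (Z_grp d3),
           conj_class (Z_minus 4)}
     else {conj_class trivial_grp, conj_class (Z_grp d2), conj_class (Z_minus d2),
           conj_class (Z_grp d3)})"
proof -
  define C where "C u = conj_class (coord_prod_stab \<inter> axial_group m u)" for u
  have m: "m \<ge> 1" using assms(1) by simp
  have e3: "C e3 = (if 4 dvd m then conj_class (Z_minus 4) else conj_class (Z_grp d2))"
    by (simp add: C_def stab_Int_axial_e3[OF m] assms(2))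
  have body: "C body_diagonal = conj_class (Z_grp d3)"
    by (simp add: C_def stab_Int_axial_body_diagonal assms(3))
  have face: "C face_diagonal = conj_class (Z_minus d2)"
    by (simp add: C_def stab_Int_axial_face_diagonal assms(2))
  have "{C u |u. u \<noteq> 0} = {conj_class trivial_grp, C e3, C body_diagonal, C face_diagonal}"
  proof (intro equalityI subsetI)
    fix X assume "X \<in> {C u |u. u \<noteq> 0}"
    then obtain u where u: "u \<noteq> 0" and X: "X = C u" by auto
    show "X \<in> {conj_class trivial_grp, C e3, C body_diagonal, C face_diagonal}"
    proof (cases "tetrahedral_coords u")
      case True
      then obtain h k a where *: "h \<in> coord_prod_stab" "k \<noteq> 0"
        "a \<in> {e3, body_diagonal, face_diagonal}" "u = k *\<^sub>R (h *v a)"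
        using on_tetrahedral_axis_coords[OF u] unfolding on_tetrahedral_axis_def by blast
      then have "a \<noteq> 0"
        using axis_nonzero[of 3] body_diagonal_nonzero face_diagonal_nonzero by auto
      then have "X = C a" using * X by (simp add: C_def axial_group_stab)
      then show ?thesis using *(3) by blast
    next
      case False
      then show ?thesis using X u by (simp add: C_def stab_Int_axial_group_trivial)
    qed
  next
    fix X assume X: "X \<in> {conj_class trivial_grp, C e3, C body_diagonal, C face_diagonal}"
    (* A line fixed by no nontrivial element of the stabiliser. *)
    define w :: "real^3" where "w = vector [1, 2, 3]"
    have "w \<noteq> 0" "\<not> tetrahedral_coords w"
      by (simp_all add: w_def tetrahedral_coords_def coord_grad_def vec_eq_iff forall_3)
    then have "C w = conj_class trivial_grp" "w \<noteq> 0"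
      by (simp_all add: C_def stab_Int_axial_group_trivial)
    then show "X \<in> {C u |u. u \<noteq> 0}"
      using X axis_nonzero[of 3] body_diagonal_nonzero face_diagonal_nonzero by blast
  qed
  (* The face diagonal contributes Z_minus d2, which the first case of the theorem calls Z_minus 2. *)
  moreover have "d2 = 2" if "4 dvd m"
    using that assms(2) by (simp add: gcd_nat.absorb1 dvd_trans[of 2 4])
  ultimately show ?thesis
    unfolding clips_O_minus_plus_Z2c[OF m] C_def[symmetric] e3 body face by auto
qed

end
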